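(* Let $\Bbbk$ be a field of characteristic $\neq 2,3$. Let $(A,\mathfrak m,\Bbbk)$ be a finite Gorenstein local $\Bbbk$-algebra whose Hilbert function is $(1,n,n,1)$ or $(1,n,\binom{n+1}{2},n,1)$ for some $n$. Then $A$ is isomorphic to its associated graded algebra $\operatorname{gr}A=\bigoplus_{i\ge 0}\mathfrak m^i/\mathfrak m^{i+1}$.
   Context: A finite $\Bbbk$-algebra is a commutative associative unital $\Bbbk$-algebra of finite dimension over $\Bbbk$. The notation $(A,\mathfrak m,\Bbbk)$ for a finite local $\Bbbk$-algebra means that $\mathfrak m$ is the maximal ideal and that $\Bbbk\to A/\mathfrak m$ is an isomorphism. Its Hilbert function is $H_A(i)=\dim_{\Bbbk}\mathfrak m^i/\mathfrak m^{i+1}$, written as the vector of its nonzero values. $A$ is Gorenstein if $\operatorname{Hom}_{\Bbbk}(A,\Bbbk)\simeq A$ as $A$-modules (equivalently the socle $(0:\mathfrak m)$ is one-dimensional over $\Bbbk$). *)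

theory Defs
  imports
    "Jordan_Normal_Form.Missing_VectorSpace"
    "HOL-Algebra.QuotRing"
    "HOL-Algebra.Ideal_Product"
begin

definition characteristic :: "('k, 'r) ring_scheme \<Rightarrow> nat"
  where "characteristic K =
    (if \<exists>p::nat. p > 0 \<and> [p] \<cdot>\<^bsub>K\<^esub> \<one>\<^bsub>K\<^esub> = \<zero>\<^bsub>K\<^esub>
     then LEAST p::nat. p > 0 \<and> [p] \<cdot>\<^bsub>K\<^esub> \<one>\<^bsub>K\<^esub> = \<zero>\<^bsub>K\<^esub> else 0)"

text \<open>A triple \<open>(A, m, K)\<close>: the commutative unital \<open>K\<close>-algebra \<open>A\<close> is finite-dimensional, \<open>m\<close> is
  its only maximal ideal, and the structure map \<open>K \<rightarrow> A/m\<close> is an isomorphism.\<close>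

locale finite_local_algebra = K: field K + algebra K A
  for K :: "('k, 'r) ring_scheme" (structure)
    and A :: "('k, 'a, 's) module_scheme" (structure)
    and m :: "'a set" +
  assumes fin_dim: "vectorspace.fin_dim K A"
    and maximal: "maximalideal m A"
    and unique_maximal: "\<And>J. maximalideal J A \<Longrightarrow> J = m"
    and residue_iso: "(\<lambda>c. m +>\<^bsub>A\<^esub> (c \<odot>\<^bsub>A\<^esub> \<one>\<^bsub>A\<^esub>)) \<in> ring_iso K (A Quot m)"

text \<open>Powers are taken in the monoid of ideals, so the zeroth power is \<open>carrier A\<close>.\<close>

abbreviation ideal_power :: "('a, 's) ring_scheme \<Rightarrow> 'a set \<Rightarrow> nat \<Rightarrow> 'a set"
  where "ideal_power A m i \<equiv> m [^]\<^bsub>ideals_set A\<^esub> i"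

text \<open>Below, the fields \<open>mult\<close> and \<open>one\<close> of a record that is only meant as a module are irrelevant
  and left \<open>undefined\<close>.\<close>

text \<open>The quotient \<open>I / J\<close> for submodules \<open>J \<subseteq> I\<close> of \<open>M\<close>; as for ring quotients (\<^const>\<open>FactRing\<close>), its elements are
  cosets of \<open>J\<close>.\<close>

definition subquotient :: "('k, 'a, 's) module_scheme \<Rightarrow> 'a set \<Rightarrow> 'a set \<Rightarrow> ('k, 'a set) module"
  where "subquotient M I J =
    \<lparr>carrier = (\<lambda>x. J +>\<^bsub>M\<^esub> x) ` I, mult = undefined, one = undefined,
     zero = J, add = set_add M,
     smult = (\<lambda>c X. \<Union>x\<in>X. J +>\<^bsub>M\<^esub> (c \<odot>\<^bsub>M\<^esub> x))\<rparr>"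

definition graded_piece :: "('k, 'a, 's) module_scheme \<Rightarrow> 'a set \<Rightarrow> nat \<Rightarrow> ('k, 'a set) module"
  where "graded_piece A m i = subquotient A (ideal_power A m i) (ideal_power A m (Suc i))"

definition hilbert_function ::
    "('k, 'r) ring_scheme \<Rightarrow> ('k, 'a, 's) module_scheme \<Rightarrow> 'a set \<Rightarrow> nat \<Rightarrow> nat"
  where "hilbert_function K A m i = vectorspace.dim K (graded_piece A m i)"

definition has_hilbert_vector ::
    "('k, 'r) ring_scheme \<Rightarrow> ('k, 'a, 's) module_scheme \<Rightarrow> 'a set \<Rightarrow> nat list \<Rightarrow> bool"
  where "has_hilbert_vector K A m h \<longleftrightarrow>
    (\<forall>i. hilbert_function K A m i = (if i < length h then h ! i else 0))"

text \<open>Elements of the direct sum are the finitely supported sequences of homogeneous components.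
  The product of \<open>a + m\<^sup>i\<^sup>+\<^sup>1\<close> and \<open>b + m\<^sup>j\<^sup>+\<^sup>1\<close> is \<open>ab + m\<^sup>i\<^sup>+\<^sup>j\<^sup>+\<^sup>1\<close>.\<close>

definition associated_graded :: "('k, 'a, 's) module_scheme \<Rightarrow> 'a set \<Rightarrow> ('k, nat \<Rightarrow> 'a set) module"
  where "associated_graded A m =
    \<lparr>carrier = {f. (\<forall>i. f i \<in> carrier (graded_piece A m i)) \<and>
                   finite {i. f i \<noteq> \<zero>\<^bsub>graded_piece A m i\<^esub>}},
     mult = (\<lambda>f g k. \<Oplus>\<^bsub>graded_piece A m k\<^esub>i\<in>{..k}.
               rcoset_mult A (ideal_power A m (Suc k)) (f i) (g (k - i))),
     one = (\<lambda>i. ideal_power A m (Suc i) +>\<^bsub>A\<^esub> (if i = 0 then \<one>\<^bsub>A\<^esub> else \<zero>\<^bsub>A\<^esub>)),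
     zero = (\<lambda>i. \<zero>\<^bsub>graded_piece A m i\<^esub>),
     add = (\<lambda>f g i. f i \<oplus>\<^bsub>graded_piece A m i\<^esub> g i),
     smult = (\<lambda>c f i. c \<odot>\<^bsub>graded_piece A m i\<^esub> f i)\<rparr>"

definition self_module :: "('a, 's) ring_scheme \<Rightarrow> ('a, 'a) module"
  where "self_module R =
    \<lparr>carrier = carrier R, mult = mult R, one = one R, zero = zero R, add = add R, smult = mult R\<rparr>"

text \<open>\<open>Hom\<^sub>K(A, K)\<close> as an \<open>A\<close>-module. Functionals are taken to be \<^const>\<open>extensional\<close> on \<open>carrier A\<close>,
  so that a functional is determined by its values on \<open>A\<close>.\<close>

definition dual_module ::
    "('k, 'r) ring_scheme \<Rightarrow> ('k, 'a, 's) module_scheme \<Rightarrow> ('a, 'a \<Rightarrow> 'k) module"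
  where "dual_module K A =
    \<lparr>carrier = module_hom K A (self_module K) \<inter> extensional (carrier A),
     mult = undefined, one = undefined,
     zero = (\<lambda>x\<in>carrier A. \<zero>\<^bsub>K\<^esub>),
     add = (\<lambda>f g. \<lambda>x\<in>carrier A. f x \<oplus>\<^bsub>K\<^esub> g x),
     smult = (\<lambda>a f. \<lambda>x\<in>carrier A. f (a \<otimes>\<^bsub>A\<^esub> x))\<rparr>"

definition module_iso ::
    "('a, 'r) ring_scheme \<Rightarrow> ('a, 'b, 's) module_scheme \<Rightarrow> ('a, 'c, 't) module_scheme \<Rightarrow> ('b \<Rightarrow> 'c) set"
  where "module_iso R M N = {f \<in> module_hom R M N. bij_betw f (carrier M) (carrier N)}"

definition gorenstein :: "('k, 'r) ring_scheme \<Rightarrow> ('k, 'a, 's) module_scheme \<Rightarrow> bool"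
  where "gorenstein K A \<longleftrightarrow> module_iso A (dual_module K A) (self_module A) \<noteq> {}"

definition algebra_iso ::
    "('k, 'r) ring_scheme \<Rightarrow> ('k, 'a, 's) module_scheme \<Rightarrow> ('k, 'b, 't) module_scheme \<Rightarrow> ('a \<Rightarrow> 'b) set"
  where "algebra_iso K A B = ring_iso A B \<inter> module_hom K A B"

end

theory Submission
  imports Defs "HOL-Algebra.UnivPoly"
begin

text \<open>The socle degree is \<open>s = 3\<close> or \<open>s = 4\<close>. Let \<open>lam\<close> be the functional corresponding to \<open>1\<close> under
  \<open>Hom(A, K) \<cong> A\<close>, so that every functional is \<open>lam (a _)\<close> for a unique \<open>a\<close>. Counting dimensions with the
  symmetric Hilbert function, the functionals vanishing on \<open>m^(s-1)\<close> are those with \<open>a \<in> m^2\<close>.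
  Choose a complement \<open>W\<close> of \<open>m^2\<close> in \<open>m\<close>, and let \<open>C\<close> be \<open>W\<close> (for \<open>s = 3\<close>) or the span of the products \<open>W W\<close>
  (for \<open>s = 4\<close>; here \<open>H(2) = (n+1 choose 2)\<close> makes \<open>C\<close> a complement of \<open>m^3\<close> in \<open>m^2\<close>).
  Replacing each \<open>u \<in> W\<close> by \<open>u + phi u\<close> with \<open>phi u \<in> m^2\<close> and \<open>lam (phi u c) = - lam (u c) / (s - 1)\<close> on \<open>C\<close>
  makes \<open>lam\<close> vanish on all products of \<open>s - 1\<close> elements of \<open>W\<close>, because a product with two corrections lies in
  \<open>m^(s+1) = 0\<close>. Then \<open>K 1\<close>, \<open>W\<close>, (the span of \<open>W W\<close>,) \<open>m^(s-1) \<inter> ker lam\<close> and \<open>m^s\<close> are the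
  homogeneous pieces of a grading of \<open>A\<close> compatible with the powers of \<open>m\<close>.\<close>

section \<open>Subspaces and subquotients\<close>

text \<open>Representatives of classes in \<open>gr A\<close> multiply correctly only modulo higher
  powers of \<open>m\<close>; the obstacle is to choose them so that products land in the chosen
  pieces exactly. The kernel of \<open>lam\<close> on \<open>m^(s-1)\<close> is a complement of
  \<open>m^s\<close> because \<open>lam\<close> is injective on \<open>m^s\<close>, which
  \<open>m\<close> annihilates. So the whole problem is that \<open>lam\<close> should kill products
  of total degree \<open>s - 1\<close>. Correcting one factor of such a product changes its value
  under \<open>lam\<close> by \<open>-1/(s - 1)\<close> times the old value. By commutativity each
  of the \<open>s - 1\<close> factors contributes the same amount, and together they cancel the
  value. This is where division by 2 (for \<open>s = 3\<close>) and by 3 (for \<open>s = 4\<close>)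
  comes from. For \<open>s = 4\<close> the functional that defines \<open>phi u\<close> is
  prescribed on products of two elements of \<open>W\<close> and has to vanish on
  \<open>m^3\<close>. The two demands could conflict if a nonzero combination of products fell into
  \<open>m^3\<close>; the largest possible value of \<open>H(2)\<close> excludes this.\<close>

context vectorspace
begin

abbreviation sdim :: "'c set \<Rightarrow> nat" where
  "sdim W \<equiv> vectorspace.dim K (vs W)"

lemma subspaceI:
  assumes "W \<subseteq> carrier V" "\<zero>\<^bsub>V\<^esub> \<in> W"
    and "\<And>x y. x \<in> W \<Longrightarrow> y \<in> W \<Longrightarrow> x \<oplus>\<^bsub>V\<^esub> y \<in> W"
    and "\<And>c x. c \<in> carrier K \<Longrightarrow> x \<in> W \<Longrightarrow> c \<odot>\<^bsub>V\<^esub> x \<in> W"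
  shows "subspace K W V"
  unfolding subspace_def submodule_def
  using assms vectorspace_axioms module_axioms by auto

lemma subspaceD:
  assumes "subspace K W V"
  shows "W \<subseteq> carrier V" "\<zero>\<^bsub>V\<^esub> \<in> W"
    and "\<And>x y. x \<in> W \<Longrightarrow> y \<in> W \<Longrightarrow> x \<oplus>\<^bsub>V\<^esub> y \<in> W"
    and "\<And>c x. c \<in> carrier K \<Longrightarrow> x \<in> W \<Longrightarrow> c \<odot>\<^bsub>V\<^esub> x \<in> W"
    and "\<And>x. x \<in> W \<Longrightarrow> \<ominus>\<^bsub>V\<^esub> x \<in> W"
    and "\<And>x y. x \<in> W \<Longrightarrow> y \<in> W \<Longrightarrow> x \<ominus>\<^bsub>V\<^esub> y \<in> W"
proof -
  have s: "submodule K W V" using assms by (rule is_module)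
  show c: "W \<subseteq> carrier V" "\<zero>\<^bsub>V\<^esub> \<in> W"
    and a: "\<And>x y. x \<in> W \<Longrightarrow> y \<in> W \<Longrightarrow> x \<oplus>\<^bsub>V\<^esub> y \<in> W"
    and m: "\<And>c x. c \<in> carrier K \<Longrightarrow> x \<in> W \<Longrightarrow> c \<odot>\<^bsub>V\<^esub> x \<in> W"
    using s unfolding submodule_def by auto
  show n: "\<ominus>\<^bsub>V\<^esub> x \<in> W" if "x \<in> W" for x
    using m[of "\<ominus>\<^bsub>K\<^esub> \<one>\<^bsub>K\<^esub>" x] that c smult_minus_1[of x] by auto
  show "x \<ominus>\<^bsub>V\<^esub> y \<in> W" if "x \<in> W" "y \<in> W" for x y
    using a[OF that(1) n[OF that(2)]] by (simp add: a_minus_def)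
qed

lemma subspace_carrier: "subspace K (carrier V) V"
  by (rule subspaceI) auto

lemma subspace_Int:
  assumes "subspace K X V" "subspace K Y V"
  shows "subspace K (X \<inter> Y) V"
  by (rule subspaceI) (use subspaceD[OF assms(1)] subspaceD[OF assms(2)] in auto)

lemma subspace_sum_mem:
  "x \<in> X \<Longrightarrow> y \<in> Y \<Longrightarrow> x \<oplus>\<^bsub>V\<^esub> y \<in> subspace_sum X Y"
  unfolding submodule_sum_def by force

lemma subspace_sumE:
  assumes "z \<in> subspace_sum X Y"
  obtains x y where "x \<in> X" "y \<in> Y" "z = x \<oplus>\<^bsub>V\<^esub> y"
  using assms unfolding submodule_sum_def by auto

section \<open>Bases and dimensions of subspaces\<close>

lemma span_subspace:
  assumes "subspace K W V" "S \<subseteq> W"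
  shows "span S \<subseteq> W"
  using span_is_subset[OF assms(2) is_module[OF assms(1)]] .

text \<open>Independence in \<open>W\<close> and in \<open>V\<close> agree, so independent subsets
  of \<open>W\<close> have at most \<open>dim\<close> elements and a maximal one exists. Finite
  dimension of \<open>W\<close> is thus a consequence (\<open>subspace_fin_dim\<close>) and not an
  input.\<close>

lemma subspace_basis:
  assumes fd: fin_dim and W: "subspace K W V"
  shows "\<exists>B. finite B \<and> B \<subseteq> W \<and> lin_indpt B \<and> span B = W \<and> card B = sdim W"
proof -
  interpret W: vectorspace K "vs W" using W by (rule subspace_is_vs)
  note Ws = subspaceD(1)[OF W] and sm = is_module[OF W]
  let ?P = "\<lambda>S. S \<subseteq> carrier (vs W) \<and> W.lin_indpt S"
  have dep: "W.lin_dep S = lin_dep S" if "S \<subseteq> W" for S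
    using span_li_not_depend(2)[OF that sm] by simp
  have "finite A \<and> card A \<le> dim" if "?P A" for A
    using that li_le_dim[OF fd, of A] dep Ws by auto
  moreover have "?P {}" by (auto simp: W.lin_dep_def)
  ultimately obtain B where B: "finite B" "maximal B ?P"
    using maximal_exists[of ?P dim "{}"] by blast
  have b: "W.basis B" by (rule W.max_li_is_basis[OF B(2)])
  then have "B \<subseteq> W" "W.lin_indpt B" "W.span B = W"
    by (auto simp: W.basis_def)
  moreover have "W.dim = card B" by (rule W.dim_basis[OF B(1) b])
  ultimately show ?thesis
    using dep[of B] span_li_not_depend(1)[of B W] sm B(1) by auto
qed

lemma subspace_fin_dim:
  assumes fin_dim and W: "subspace K W V"
  shows "vectorspace.fin_dim K (vs W)"
proof -
  interpret W: vectorspace K "vs W" using W by (rule subspace_is_vs)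
  obtain B where "finite B" "B \<subseteq> W" "span B = W"
    using subspace_basis[OF assms] by blast
  then show ?thesis
    using span_li_not_depend(1)[of B W] is_module[OF W] by (auto simp: W.fin_dim_def)
qed

lemma sdim_span_le:
  assumes "finite B" "B \<subseteq> carrier V"
  shows "sdim (span B) \<le> card B"
proof -
  have s: "subspace K (span B) V" by (rule span_is_subspace[OF assms(2)])
  interpret W: vectorspace K "vs (span B)" using s by (rule subspace_is_vs)
  have "B \<subseteq> span B" using in_own_span[OF assms(2)] .
  then show ?thesis
    using W.gen_ge_dim[OF assms(1)] span_li_not_depend(1)[of B "span B"] is_module[OF s] by auto
qed

lemma li_card_le_sdim:
  assumes fin_dim "subspace K W V" "B \<subseteq> W" "lin_indpt B"
  shows "card B \<le> sdim W"
proof -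
  interpret W: vectorspace K "vs W" using assms(2) by (rule subspace_is_vs)
  show ?thesis
    using W.li_le_dim(2)[OF subspace_fin_dim[OF assms(1,2)], of B]
      span_li_not_depend(2)[OF assms(3) is_module[OF assms(2)]] assms(3,4) by auto
qed

lemma sdim_mono:
  assumes fin_dim "subspace K X V" "subspace K Y V" "X \<subseteq> Y"
  shows "sdim X \<le> sdim Y"
proof -
  obtain B where "B \<subseteq> X" "lin_indpt B" "card B = sdim X"
    using subspace_basis[OF assms(1,2)] by blast
  then show ?thesis
    using li_card_le_sdim[OF assms(1,3), of B] assms(4) by (metis subset_trans)
qed

text \<open>A vector of \<open>Y\<close> outside \<open>X\<close> would extend a basis of
  \<open>X\<close> to an independent subset of \<open>Y\<close> that is too large.\<close>

lemma subspace_eqI: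
  assumes fin_dim "subspace K X V" "subspace K Y V" "X \<subseteq> Y" "sdim Y \<le> sdim X"
  shows "X = Y"
proof (rule ccontr)
  assume "X \<noteq> Y"
  then obtain v where v: "v \<in> Y" "v \<notin> X" using assms(4) by auto
  obtain B where B: "finite B" "B \<subseteq> X" "lin_indpt B" "span B = X" "card B = sdim X"
    using subspace_basis[OF assms(1,2)] by blast
  have c: "B \<subseteq> carrier V" "v \<in> carrier V"
    using B(2) subspaceD(1)[OF assms(2)] v subspaceD(1)[OF assms(3)] by auto
  have "v \<notin> B" using v B by auto
  then have "lin_indpt (B \<union> {v})"
    using lin_dep_iff_in_span[OF c(1) B(3) c(2)] v(2) B(4) by auto
  then have "card (B \<union> {v}) \<le> sdim Y"
    using li_card_le_sdim[OF assms(1,3)] B(2) assms(4) v(1) by auto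
  then show False using \<open>v \<notin> B\<close> B(1,5) assms(5) by simp
qed

section \<open>Maximal subspaces, complements and projections\<close>

text \<open>A member of largest dimension is maximal for inclusion. This takes the place of Zorn's
  lemma for complements, for maximal ideals and for the maximal proper subideal in Nakayama's
  lemma.\<close>

lemma maximal_subspace_exists:
  assumes fin_dim "P W0" and sub: "\<And>W. P W \<Longrightarrow> subspace K W V"
  obtains W where "P W" "\<And>W'. P W' \<Longrightarrow> W \<subseteq> W' \<Longrightarrow> W' = W"
proof -
  have "sdim W \<le> sdim (carrier V)" if "P W" for W
    using sdim_mono[OF assms(1) sub[OF that] subspace_carrier] subspaceD(1)[OF sub[OF that]] by simp
  then obtain W where W: "P W" "\<And>W'. P W' \<Longrightarrow> sdim W' \<le> sdim W"
    using ex_has_greatest_nat[of P W0 sdim "Suc (sdim (carrier V))"] assms(2)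
    by (metis less_Suc_eq_le)
  show thesis
  proof (rule that[OF W(1)])
    fix W' assume W': "P W'" "W \<subseteq> W'"
    show "W' = W"
      using subspace_eqI[OF assms(1) sub[OF W(1)] sub[OF W'(1)] W'(2) W(2)[OF W'(1)]] by (rule sym)
  qed
qed

text \<open>\<open>Z\<close> is maximal among the subspaces that contain \<open>Y\<close> and meet
  \<open>X\<close> trivially; a vector outside \<open>X + Z\<close> could still be adjoined to it.
  Prescribing \<open>Y\<close> is what later yields a projection that vanishes on
  \<open>Y\<close>.\<close>

lemma complement_exists:
  assumes fd: fin_dim and X: "subspace K X V" and Y: "subspace K Y V" and XY: "X \<inter> Y = {\<zero>\<^bsub>V\<^esub>}"
  obtains Z where "subspace K Z V" "Y \<subseteq> Z" "X \<inter> Z = {\<zero>\<^bsub>V\<^esub>}" "subspace_sum X Z = carrier V"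
proof -
  let ?P = "\<lambda>Z. subspace K Z V \<and> Y \<subseteq> Z \<and> X \<inter> Z = {\<zero>\<^bsub>V\<^esub>}"
  have "?P Y" using Y XY by blast
  then obtain Z where Z: "?P Z" and mx: "\<And>Z'. ?P Z' \<Longrightarrow> Z \<subseteq> Z' \<Longrightarrow> Z' = Z"
    by (rule maximal_subspace_exists[of ?P Y, OF fd]) blast+
  note Xs = subspaceD[OF X] and Zs = subspaceD[OF conjunct1[OF Z]]
  have "v \<in> subspace_sum X Z" if v: "v \<in> carrier V" for v
  proof (rule ccontr)
    assume nv: "v \<notin> subspace_sum X Z"
    let ?Z = "subspace_sum Z (span {v})"
    have s: "subspace K (span {v}) V" by (rule span_is_subspace) (use v in simp)
    have sZ: "subspace K ?Z V" by (rule sum_is_subspace[OF conjunct1[OF Z] s])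
    have ZZ: "Z \<subseteq> ?Z" by (rule in_sum_vs[OF conjunct1[OF Z] s])
    have spv: "span {v} = {c \<odot>\<^bsub>V\<^esub> v |c. c \<in> carrier K}"
    proof -
      have "lincomb a {v} = a v \<odot>\<^bsub>V\<^esub> v" if "a v \<in> carrier K" for a
        using that v by (simp add: lincomb_def)
      moreover have "span {v} = {lincomb a {v} |a. a \<in> {v} \<rightarrow> carrier K}"
        by (rule finite_span) (use v in auto)
      moreover have "\<exists>a. c \<odot>\<^bsub>V\<^esub> v = lincomb a {v} \<and> a \<in> {v} \<rightarrow> carrier K"
        if "c \<in> carrier K" for c
        by (rule exI[of _ "\<lambda>_. c"]) (use that v in \<open>auto simp: lincomb_def\<close>)
      ultimately show ?thesis by fastforce
    qed
    have "x = \<zero>\<^bsub>V\<^esub>" if x: "x \<in> X" "x \<in> ?Z" for x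
    proof -
      obtain z c where zc: "z \<in> Z" "c \<in> carrier K" "x = z \<oplus>\<^bsub>V\<^esub> c \<odot>\<^bsub>V\<^esub> v"
        using x(2) spv by (auto elim!: subspace_sumE)
      have car: "z \<in> carrier V" "x \<in> carrier V" using zc x Xs(1) Zs(1) by auto
      show ?thesis
      proof (cases "c = \<zero>\<^bsub>K\<^esub>")
        case True
        then show ?thesis using zc v x Z car by auto
      next
        case False
        \<comment> \<open>With a nonzero coefficient \<open>c\<close>, the relation
          \<open>x = z + c v\<close> can be solved for \<open>v\<close>, which would put
          \<open>v\<close> into \<open>X + Z\<close>.\<close>
        have "c \<odot>\<^bsub>V\<^esub> v = x \<oplus>\<^bsub>V\<^esub> \<ominus>\<^bsub>V\<^esub> z"
          using zc v car by (simp add: M.a_ac M.r_neg1 M.r_neg2)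
        then have "c \<odot>\<^bsub>V\<^esub> v \<in> subspace_sum X Z"
          using subspace_sum_mem x(1) Zs(5)[OF zc(1)] by metis
        then have "inv\<^bsub>K\<^esub> c \<odot>\<^bsub>V\<^esub> (c \<odot>\<^bsub>V\<^esub> v) \<in> subspace_sum X Z"
          using subspaceD(4)[OF sum_is_subspace[OF X conjunct1[OF Z]]] zc(2) False by auto
        moreover have "inv\<^bsub>K\<^esub> c \<odot>\<^bsub>V\<^esub> (c \<odot>\<^bsub>V\<^esub> v) = v"
          using mult_inverse[OF zc(2) v refl False] by simp
        ultimately show ?thesis using nv by simp
      qed
    qed
    then have "?P ?Z" using sZ ZZ Z Xs(2) subspaceD(2)[OF sZ] by blast
    then have "?Z = Z" using mx ZZ by blast
    moreover have "v \<in> ?Z"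
      using subspace_sum_mem[OF Zs(2), of v "span {v}"] v in_own_span[of "{v}"] by auto
    moreover have "Z \<subseteq> subspace_sum X Z"
      using in_sum_vs[OF conjunct1[OF Z] X] vsum_comm[OF X conjunct1[OF Z]] by simp
    ultimately show False using nv by auto
  qed
  then have "subspace_sum X Z = carrier V"
    using subspaceD(1)[OF sum_is_subspace[OF X conjunct1[OF Z]]] by blast
  then show thesis
    by (rule that[OF conjunct1[OF Z] conjunct1[OF conjunct2[OF Z]] conjunct2[OF conjunct2[OF Z]]])
qed

lemma module_homI:
  assumes "\<And>x. x \<in> carrier V \<Longrightarrow> f x \<in> carrier N"
    and "\<And>x y. x \<in> carrier V \<Longrightarrow> y \<in> carrier V \<Longrightarrow> f (x \<oplus>\<^bsub>V\<^esub> y) = f x \<oplus>\<^bsub>N\<^esub> f y"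
    and "\<And>c x. c \<in> carrier K \<Longrightarrow> x \<in> carrier V \<Longrightarrow> f (c \<odot>\<^bsub>V\<^esub> x) = c \<odot>\<^bsub>N\<^esub> f x"
  shows "f \<in> module_hom K V N"
  unfolding module_hom_def using assms by blast

text \<open>The projection onto \<open>X\<close> along a complement that contains \<open>Y\<close>.
  With \<open>Y = 0\<close> its kernel provides complements of powers of \<open>m\<close>; with
  \<open>Y\<close> a power of \<open>m\<close> it extends functionals from \<open>X\<close> by zero
  on \<open>Y\<close>.\<close>

lemma projection_exists:
  assumes fd: fin_dim and X: "subspace K X V" and Y: "subspace K Y V" and XY: "X \<inter> Y = {\<zero>\<^bsub>V\<^esub>}"
  obtains p where "p \<in> module_hom K V V" "\<And>x. x \<in> carrier V \<Longrightarrow> p x \<in> X"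
    "\<And>x. x \<in> X \<Longrightarrow> p x = x" "\<And>y. y \<in> Y \<Longrightarrow> p y = \<zero>\<^bsub>V\<^esub>"
proof -
  obtain Z where Z: "subspace K Z V" "Y \<subseteq> Z" "X \<inter> Z = {\<zero>\<^bsub>V\<^esub>}" "subspace_sum X Z = carrier V"
    using complement_exists[OF assms] by blast
  note Xs = subspaceD[OF X] and Zs = subspaceD[OF Z(1)]
  have uniq: "x = x'" if "x \<in> X" "z \<in> Z" "x' \<in> X" "z' \<in> Z" "x \<oplus>\<^bsub>V\<^esub> z = x' \<oplus>\<^bsub>V\<^esub> z'" for x x' z z'
  proof -
    have c: "x \<in> carrier V" "x' \<in> carrier V" "z \<in> carrier V" "z' \<in> carrier V"
      using that Xs(1) Zs(1) by auto
    have "x = x' \<oplus>\<^bsub>V\<^esub> z' \<ominus>\<^bsub>V\<^esub> z"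
      using that(5) c by (metis M.add.inv_closed M.a_assoc M.minus_eq M.r_neg M.r_zero)
    then have "x = (z' \<ominus>\<^bsub>V\<^esub> z) \<oplus>\<^bsub>V\<^esub> x'"
      using c by (simp add: M.minus_eq M.a_ac)
    then have "x \<ominus>\<^bsub>V\<^esub> x' = z' \<ominus>\<^bsub>V\<^esub> z"
      using c by (simp add: M.minus_eq M.a_assoc M.r_neg)
    then have "x \<ominus>\<^bsub>V\<^esub> x' = \<zero>\<^bsub>V\<^esub>"
      using Xs(6)[OF that(1,3)] Zs(6)[OF that(4,2)] Z(3) by auto
    then show ?thesis using c by simp
  qed
  \<comment> \<open>The \<open>X\<close>-component of \<open>v\<close>; \<open>uniq\<close> shows
    that the description determines it.\<close>
  define p where "p v = (THE x. x \<in> X \<and> (\<exists>z\<in>Z. v = x \<oplus>\<^bsub>V\<^esub> z))" for v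
  have p: "p (x \<oplus>\<^bsub>V\<^esub> z) = x" if "x \<in> X" "z \<in> Z" for x z
    unfolding p_def
  proof (rule the_equality)
    show "x \<in> X \<and> (\<exists>za\<in>Z. x \<oplus>\<^bsub>V\<^esub> z = x \<oplus>\<^bsub>V\<^esub> za)" using that by blast
    show "x' = x" if x': "x' \<in> X \<and> (\<exists>za\<in>Z. x \<oplus>\<^bsub>V\<^esub> z = x' \<oplus>\<^bsub>V\<^esub> za)" for x'
    proof -
      obtain za where "za \<in> Z" "x \<oplus>\<^bsub>V\<^esub> z = x' \<oplus>\<^bsub>V\<^esub> za" using x' by auto
      then show ?thesis using uniq[of x' za x z] x' \<open>x \<in> X\<close> \<open>z \<in> Z\<close> by simp
    qed
  qed
  have dec: "\<exists>x z. x \<in> X \<and> z \<in> Z \<and> v = x \<oplus>\<^bsub>V\<^esub> z \<and> p v = x \<and> x \<in> carrier V \<and> z \<in> carrier V"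
    if "v \<in> carrier V" for v
  proof -
    obtain x z where "x \<in> X" "z \<in> Z" "v = x \<oplus>\<^bsub>V\<^esub> z"
      using \<open>v \<in> carrier V\<close> unfolding Z(4)[symmetric] by (rule subspace_sumE)
    then show ?thesis using p[of x z] Xs(1) Zs(1) by (intro exI[of _ x] exI[of _ z]) auto
  qed
  show thesis
  proof (rule that)
    show "p x \<in> X" if "x \<in> carrier V" for x using dec[OF that] by auto
    show "p x = x" if "x \<in> X" for x
      using p[OF that Zs(2)] that Xs(1) by auto
    show "p y = \<zero>\<^bsub>V\<^esub>" if "y \<in> Y" for y
      using p[OF Xs(2), of y] that Z(2) Zs(1) by (auto simp: subset_eq)
    show "p \<in> module_hom K V V"
    proof (rule module_homI)
      show "p x \<in> carrier V" if "x \<in> carrier V" for x using dec[OF that] by auto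
      show "p (v \<oplus>\<^bsub>V\<^esub> v') = p v \<oplus>\<^bsub>V\<^esub> p v'" if v: "v \<in> carrier V" "v' \<in> carrier V" for v v'
      proof -
        obtain x z x' z' where *: "x \<in> X" "z \<in> Z" "v = x \<oplus>\<^bsub>V\<^esub> z" "p v = x"
          "x' \<in> X" "z' \<in> Z" "v' = x' \<oplus>\<^bsub>V\<^esub> z'" "p v' = x'"
          and c: "x \<in> carrier V" "x' \<in> carrier V" "z \<in> carrier V" "z' \<in> carrier V"
          using dec[OF v(1)] dec[OF v(2)] by metis
        have "v \<oplus>\<^bsub>V\<^esub> v' = (x \<oplus>\<^bsub>V\<^esub> x') \<oplus>\<^bsub>V\<^esub> (z \<oplus>\<^bsub>V\<^esub> z')"
          using * c by (simp add: M.a_ac)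
        then show ?thesis using p[OF Xs(3)[OF *(1,5)] Zs(3)[OF *(2,6)]] * by simp
      qed
      show "p (c \<odot>\<^bsub>V\<^esub> v) = c \<odot>\<^bsub>V\<^esub> p v" if cv: "c \<in> carrier K" "v \<in> carrier V" for c v
      proof -
        obtain x z where *: "x \<in> X" "z \<in> Z" "v = x \<oplus>\<^bsub>V\<^esub> z" "p v = x"
          and c: "x \<in> carrier V" "z \<in> carrier V"
          using dec[OF cv(2)] by metis
        then show ?thesis
          using p[OF Xs(4)[OF cv(1) *(1)] Zs(4)[OF cv(1) *(2)]] cv(1)
          by (simp add: smult_r_distr)
      qed
    qed
  qed
qed

section \<open>Cosets and subquotient spaces\<close>

lemma subspace_abelian_subgroup:
  assumes "subspace K J V"
  shows "abelian_subgroup J V"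
proof (rule abelian_subgroupI3)
  show "additive_subgroup J V"
    unfolding additive_subgroup_def
    using subspaceD[OF assms] M.add.subgroupI[of J]
    by (auto simp: a_inv_def)
qed (rule M.abelian_group_axioms)

lemma coset_eq_iff:
  assumes J: "subspace K J V" and x: "x \<in> carrier V" and y: "y \<in> carrier V"
  shows "J +>\<^bsub>V\<^esub> x = J +>\<^bsub>V\<^esub> y \<longleftrightarrow> x \<ominus>\<^bsub>V\<^esub> y \<in> J"
proof -
  interpret J: abelian_subgroup J V by (rule subspace_abelian_subgroup[OF J])
  have "x \<in> J +>\<^bsub>V\<^esub> y \<longleftrightarrow> x \<ominus>\<^bsub>V\<^esub> y \<in> J"
    using J.a_rcos_module[OF y x] by (simp add: M.minus_eq)
  moreover have "J +>\<^bsub>V\<^esub> y = J +>\<^bsub>V\<^esub> x" if "x \<in> J +>\<^bsub>V\<^esub> y"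
    by (rule M.a_repr_independence[OF that y J.a_subgroup])
  ultimately show ?thesis using J.a_rcos_self[OF x] by auto
qed

lemma coset_add:
  assumes "subspace K J V" "x \<in> carrier V" "y \<in> carrier V"
  shows "(J +>\<^bsub>V\<^esub> x) <+>\<^bsub>V\<^esub> (J +>\<^bsub>V\<^esub> y) = J +>\<^bsub>V\<^esub> (x \<oplus>\<^bsub>V\<^esub> y)"
  by (rule abelian_subgroup.a_rcos_sum[OF subspace_abelian_subgroup[OF assms(1)] assms(2,3)])

lemma coset_zero:
  assumes "subspace K J V"
  shows "J +>\<^bsub>V\<^esub> \<zero>\<^bsub>V\<^esub> = J"
  using subspaceD(1)[OF assms] by simp

lemma coset_memD:
  assumes J: "subspace K J V" and x: "x \<in> carrier V" and y: "y \<in> J +>\<^bsub>V\<^esub> x"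
  shows "y \<in> carrier V" "y \<ominus>\<^bsub>V\<^esub> x \<in> J"
proof -
  interpret J: abelian_subgroup J V by (rule subspace_abelian_subgroup[OF J])
  show "y \<in> carrier V" using y x subspaceD(1)[OF J] by (auto simp: a_r_coset_def')
  then show "y \<ominus>\<^bsub>V\<^esub> x \<in> J"
    using J.a_rcos_module[OF x] y by (simp add: M.minus_eq)
qed

lemma coset_self:
  assumes "subspace K J V" "x \<in> carrier V"
  shows "x \<in> J +>\<^bsub>V\<^esub> x"
  using abelian_subgroup.a_rcos_self[OF subspace_abelian_subgroup[OF assms(1)] assms(2)] .

text \<open>Scalar multiplication in \<open>subquotient\<close> is a union over all representatives.
  Its members coincide, and the coset is nonempty, so the union collapses to a single coset.\<close>

lemma coset_smult:
  assumes J: "subspace K J V" and x: "x \<in> carrier V" and c: "c \<in> carrier K"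
  shows "c \<odot>\<^bsub>subquotient V I J\<^esub> (J +>\<^bsub>V\<^esub> x) = J +>\<^bsub>V\<^esub> (c \<odot>\<^bsub>V\<^esub> x)"
proof -
  have "J +>\<^bsub>V\<^esub> (c \<odot>\<^bsub>V\<^esub> y) = J +>\<^bsub>V\<^esub> (c \<odot>\<^bsub>V\<^esub> x)" if "y \<in> J +>\<^bsub>V\<^esub> x" for y
  proof -
    note y = coset_memD[OF J x that]
    have "c \<odot>\<^bsub>V\<^esub> y \<ominus>\<^bsub>V\<^esub> c \<odot>\<^bsub>V\<^esub> x = c \<odot>\<^bsub>V\<^esub> (y \<ominus>\<^bsub>V\<^esub> x)"
      using y(1) x c by (simp add: M.minus_eq smult_r_distr smult_r_minus)
    then show ?thesis using coset_eq_iff[OF J] y x c subspaceD(4)[OF J] by simp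
  qed
  then have "(\<Union>y\<in>J +>\<^bsub>V\<^esub> x. J +>\<^bsub>V\<^esub> (c \<odot>\<^bsub>V\<^esub> y)) = (\<Union>y\<in>J +>\<^bsub>V\<^esub> x. J +>\<^bsub>V\<^esub> (c \<odot>\<^bsub>V\<^esub> x))"
    by (rule SUP_cong[OF refl])
  also have "\<dots> = J +>\<^bsub>V\<^esub> (c \<odot>\<^bsub>V\<^esub> x)"
    using coset_self[OF J x] by (metis UN_constant empty_iff)
  finally show ?thesis by (simp add: subquotient_def)
qed

lemma subquotient_add [simp]: "add (subquotient V I J) = set_add V"
  and subquotient_zero [simp]: "\<zero>\<^bsub>subquotient V I J\<^esub> = J"
  and subquotient_carrier: "carrier (subquotient V I J) = (\<lambda>x. J +>\<^bsub>V\<^esub> x) ` I"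
  by (simp_all add: subquotient_def)

lemma subquotient_vectorspace:
  assumes J: "subspace K J V" and I: "subspace K I V"
  shows "vectorspace K (subquotient V I J)"
proof -
  note Is = subspaceD[OF I]
  have c: "x \<in> carrier V" if "x \<in> I" for x using that Is(1) by auto
  have "abelian_group (subquotient V I J)"
  proof (rule abelian_groupI; unfold subquotient_add subquotient_zero subquotient_carrier)
    show "J \<in> (+>\<^bsub>V\<^esub>) J ` I" using imageI[OF Is(2), of "(+>\<^bsub>V\<^esub>) J"] unfolding coset_zero[OF J] .
    fix X assume "X \<in> (+>\<^bsub>V\<^esub>) J ` I"
    then obtain x where x: "x \<in> I" "X = J +>\<^bsub>V\<^esub> x" by blast
    show "J <+>\<^bsub>V\<^esub> X = X"
      using coset_add[OF J, of "\<zero>\<^bsub>V\<^esub>" x] coset_zero[OF J] c x by simp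
    show "\<exists>Y\<in>(+>\<^bsub>V\<^esub>) J ` I. Y <+>\<^bsub>V\<^esub> X = J"
      using coset_add[OF J, of "\<ominus>\<^bsub>V\<^esub> x" x] coset_zero[OF J] c x Is(5)[OF x(1)] by (auto simp: M.l_neg)
    fix Y assume "Y \<in> (+>\<^bsub>V\<^esub>) J ` I"
    then obtain y where y: "y \<in> I" "Y = J +>\<^bsub>V\<^esub> y" by blast
    show "X <+>\<^bsub>V\<^esub> Y \<in> (+>\<^bsub>V\<^esub>) J ` I"
      using coset_add[OF J] c x y Is(3) by simp
    show "X <+>\<^bsub>V\<^esub> Y = Y <+>\<^bsub>V\<^esub> X"
      using coset_add[OF J] c x y by (simp add: M.a_comm)
    fix Z assume "Z \<in> (+>\<^bsub>V\<^esub>) J ` I"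
    then obtain z where z: "z \<in> I" "Z = J +>\<^bsub>V\<^esub> z" by blast
    show "X <+>\<^bsub>V\<^esub> Y <+>\<^bsub>V\<^esub> Z = X <+>\<^bsub>V\<^esub> (Y <+>\<^bsub>V\<^esub> Z)"
      using coset_add[OF J] c x y z by (simp add: M.a_assoc)
  qed
  moreover have "module K (subquotient V I J)"
  proof (rule moduleI[OF R.is_cring \<open>abelian_group (subquotient V I J)\<close>];
      unfold subquotient_add subquotient_zero subquotient_carrier)
    show "\<one>\<^bsub>K\<^esub> \<odot>\<^bsub>subquotient V I J\<^esub> X = X" if "X \<in> (+>\<^bsub>V\<^esub>) J ` I" for X
      using that coset_smult[OF J c] c by auto
    fix X a assume "X \<in> (+>\<^bsub>V\<^esub>) J ` I" and a: "a \<in> carrier K"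
    then obtain x where x: "x \<in> I" "X = J +>\<^bsub>V\<^esub> x" by blast
    note sm = coset_smult[OF J c]
    show "a \<odot>\<^bsub>subquotient V I J\<^esub> X \<in> (+>\<^bsub>V\<^esub>) J ` I" using sm x a Is(4) by simp
    fix b assume b: "b \<in> carrier K"
    show "(a \<oplus>\<^bsub>K\<^esub> b) \<odot>\<^bsub>subquotient V I J\<^esub> X =
        a \<odot>\<^bsub>subquotient V I J\<^esub> X <+>\<^bsub>V\<^esub> b \<odot>\<^bsub>subquotient V I J\<^esub> X"
      using sm coset_add[OF J] x a b c by (simp add: smult_l_distr)
    show "(a \<otimes>\<^bsub>K\<^esub> b) \<odot>\<^bsub>subquotient V I J\<^esub> X =
        a \<odot>\<^bsub>subquotient V I J\<^esub> (b \<odot>\<^bsub>subquotient V I J\<^esub> X)"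
      using sm[of x] coset_smult[OF J, of "b \<odot>\<^bsub>V\<^esub> x"] x a b c by (simp add: smult_assoc1)
    fix Y assume "Y \<in> (+>\<^bsub>V\<^esub>) J ` I"
    then obtain y where y: "y \<in> I" "Y = J +>\<^bsub>V\<^esub> y" by blast
    show "a \<odot>\<^bsub>subquotient V I J\<^esub> (X <+>\<^bsub>V\<^esub> Y) =
        a \<odot>\<^bsub>subquotient V I J\<^esub> X <+>\<^bsub>V\<^esub> a \<odot>\<^bsub>subquotient V I J\<^esub> Y"
      using coset_add[OF J] coset_smult[OF J] x y a c by (simp add: smult_r_distr)
  qed
  ultimately show ?thesis
    unfolding vectorspace_def using field.field_axioms by simp
qed

text \<open>Rank-nullity for \<open>X \<rightarrow> I/J\<close>, which is onto by
  \<open>spanning\<close> and has kernel \<open>X \<inter> J\<close>. \<open>X\<close> is kept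
  separate from \<open>I\<close> so that one statement covers \<open>I\<close> itself, candidates
  for complements of \<open>J\<close>, and direct summands.\<close>

lemma sdim_subquotient:
  assumes fd: fin_dim and J: "subspace K J V" and I: "subspace K I V" and X: "subspace K X V"
    and XI: "X \<subseteq> I" and spanning: "\<And>x. x \<in> I \<Longrightarrow> \<exists>y\<in>X. x \<ominus>\<^bsub>V\<^esub> y \<in> J"
  shows "sdim X = sdim (X \<inter> J) + vectorspace.dim K (subquotient V I J)"
proof -
  let ?Q = "subquotient V I J" and ?T = "\<lambda>x. J +>\<^bsub>V\<^esub> x"
  note Xs = subspaceD[OF X] and Is = subspaceD[OF I]
  interpret X: vectorspace K "vs X" using X by (rule subspace_is_vs)
  interpret Q: vectorspace K ?Q by (rule subquotient_vectorspace[OF J I])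
  have "?T \<in> module_hom K (vs X) ?Q"
    unfolding module_hom_def subquotient_add subquotient_carrier
    using XI Xs coset_add[OF J] coset_smult[OF J, where I=I] by (auto simp: subset_iff)
  then interpret T: linear_map K "vs X" ?Q ?T
    by unfold_locales
  have "T.im = carrier ?Q"
  proof -
    have "J +>\<^bsub>V\<^esub> x \<in> ?T ` X" if "x \<in> I" for x
      using spanning[OF that] coset_eq_iff[OF J, of x] that Is(1) Xs(1) by blast
    then show ?thesis using XI by (auto simp: T.im_def subquotient_carrier)
  qed
  then have im: "?Q\<lparr>carrier := T.im\<rparr> = ?Q" by simp
  have "x \<in> J \<longleftrightarrow> J +>\<^bsub>V\<^esub> x = J" if "x \<in> X" for x
  proof -
    have "x \<in> carrier V" using that Xs(1) by auto
    then show ?thesis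
      using coset_eq_iff[OF J, of x "\<zero>\<^bsub>V\<^esub>"] M.minus_equality[of "\<zero>\<^bsub>V\<^esub>" "\<zero>\<^bsub>V\<^esub>"]
      by (simp add: coset_zero[OF J] M.minus_eq)
  qed
  then have "T.ker = X \<inter> J" by (auto simp: T.ker_def)
  then show ?thesis
    using T.rank_nullity[OF subspace_fin_dim[OF fd X]] im by simp
qed

text \<open>Both \<open>X\<close> and \<open>X + Y\<close> map onto \<open>(X + Y)/Y\<close>, with
  kernels \<open>0\<close> and \<open>Y\<close>; comparing the two dimension formulas gives the
  sum.\<close>

lemma sdim_direct_sum:
  assumes fd: fin_dim and X: "subspace K X V" and Y: "subspace K Y V" and XY: "X \<inter> Y = {\<zero>\<^bsub>V\<^esub>}"
  shows "sdim (subspace_sum X Y) = sdim X + sdim Y"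
proof -
  let ?S = "subspace_sum X Y"
  note Xs = subspaceD[OF X] and Ys = subspaceD[OF Y]
  have S: "subspace K ?S V" by (rule sum_is_subspace[OF X Y])
  have XS: "X \<subseteq> ?S" by (rule in_sum_vs[OF X Y])
  have YS: "Y \<subseteq> ?S" using in_sum_vs[OF Y X] vsum_comm[OF X Y] by simp
  have "\<exists>y\<in>X. s \<ominus>\<^bsub>V\<^esub> y \<in> Y" if s: "s \<in> ?S" for s
  proof -
    obtain x y where xy: "x \<in> X" "y \<in> Y" "s = x \<oplus>\<^bsub>V\<^esub> y" using s by (rule subspace_sumE)
    then have c: "x \<in> carrier V" "y \<in> carrier V" using Xs(1) Ys(1) by auto
    then have "s \<ominus>\<^bsub>V\<^esub> x = y"
      using xy(3) M.a_comm[OF c] by (simp add: M.minus_eq M.a_assoc M.r_neg)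
    then show ?thesis using xy(1,2) by metis
  qed
  then have 1: "sdim X = sdim (X \<inter> Y) + vectorspace.dim K (subquotient V ?S Y)"
    by (rule sdim_subquotient[OF fd Y S X XS])
  have "s \<ominus>\<^bsub>V\<^esub> s \<in> Y" if "s \<in> ?S" for s
    using that subspaceD(1)[OF S] Ys(2) by (auto simp: M.minus_eq M.r_neg subset_iff)
  then have 2: "sdim ?S = sdim (?S \<inter> Y) + vectorspace.dim K (subquotient V ?S Y)"
    by (intro sdim_subquotient[OF fd Y S S subset_refl]) blast
  have "sdim (X \<inter> Y) = 0"
    using sdim_span_le[of "{}"] by (simp add: XY span_empty)
  moreover have "?S \<inter> Y = Y" using YS by auto
  ultimately show ?thesis using 1 2 by simp
qed

end

section \<open>Powers of the maximal ideal\<close>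

sublocale finite_local_algebra \<subseteq> V: vectorspace K A
  by unfold_locales

context finite_local_algebra
begin

definition mpow :: "nat \<Rightarrow> 'a set" where
  "mpow i = ideal_power A m i"

lemma m_ideal: "ideal m A"
  using maximal by (rule maximalideal.axioms(1))

lemma ideals_monoid: "Group.monoid (ideals_set A)"
  by (rule comm_monoid.axioms(1)[OF ideals_set_is_comm_monoid])

lemma mpow_ideal: "ideal (mpow i) A"
  using monoid.nat_pow_closed[OF ideals_monoid, of m i] m_ideal by (simp add: mpow_def ideals_set_def)

lemma mpow_0 [simp]: "mpow 0 = carrier A"
  by (simp add: mpow_def ideals_set_def)

lemma mpow_Suc: "mpow (Suc i) = ideal_prod A (mpow i) m"
  by (simp add: mpow_def ideals_set_def)

lemma mpow_1: "mpow (Suc 0) = m"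
  using monoid.nat_pow_one[OF ideals_monoid] monoid.l_one[OF ideals_monoid, of m] m_ideal
  by (simp add: mpow_def ideals_set_def)

lemma mpow_mult: "ideal_prod A (mpow i) (mpow j) = mpow (i + j)"
  using monoid.nat_pow_mult[OF ideals_monoid, of m i j] m_ideal by (simp add: mpow_def ideals_set_def)

text \<open>A scalar multiple \<open>c x\<close> is the ring product of \<open>c 1\<close> and
  \<open>x\<close>, so absorption covers it.\<close>

lemma ideal_subspace:
  assumes "ideal I A"
  shows "subspace K I A"
proof -
  interpret I: ideal I A by fact
  show ?thesis
  proof (rule V.subspaceI)
    show "I \<subseteq> carrier A" using I.a_subset .
    show "\<zero>\<^bsub>A\<^esub> \<in> I" by (rule I.zero_closed)
    show "x \<oplus>\<^bsub>A\<^esub> y \<in> I" if "x \<in> I" "y \<in> I" for x y using that by (rule I.a_closed)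
    show "c \<odot>\<^bsub>A\<^esub> x \<in> I" if "c \<in> carrier K" "x \<in> I" for c x
    proof -
      have x: "x \<in> carrier A" using that(2) by (rule I.a_Hcarr)
      have "c \<odot>\<^bsub>A\<^esub> x = (c \<odot>\<^bsub>A\<^esub> \<one>\<^bsub>A\<^esub>) \<otimes>\<^bsub>A\<^esub> x"
        using smult_assoc2[OF that(1) _ x, of "\<one>\<^bsub>A\<^esub>"] x by simp
      then show ?thesis using I.I_l_closed[OF that(2), of "c \<odot>\<^bsub>A\<^esub> \<one>\<^bsub>A\<^esub>"] that(1) by simp
    qed
  qed
qed

lemma mpow_subspace: "subspace K (mpow i) A"
  by (rule ideal_subspace[OF mpow_ideal])

lemmas mpow_closed = V.subspaceD[OF mpow_subspace]

lemma mpow_carrier: "x \<in> mpow i \<Longrightarrow> x \<in> carrier A"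
  using mpow_closed(1) by blast

lemma mpow_mult_mem: "x \<in> mpow i \<Longrightarrow> y \<in> mpow j \<Longrightarrow> x \<otimes>\<^bsub>A\<^esub> y \<in> mpow (i + j)"
  unfolding mpow_mult[symmetric] by (rule ideal_prod.prod)

lemma mpow_antimono: "i \<le> j \<Longrightarrow> mpow j \<subseteq> mpow i"
  using mpow_mult[of i "j - i"] ideal_prod_inter[OF mpow_ideal mpow_ideal, of i "j - i"] by auto

lemma ideal_prod_subset:
  assumes W: "subspace K W A" and IJ: "\<And>x y. x \<in> I \<Longrightarrow> y \<in> J \<Longrightarrow> x \<otimes>\<^bsub>A\<^esub> y \<in> W"
  shows "ideal_prod A I J \<subseteq> W"
proof
  fix s assume "s \<in> ideal_prod A I J"
  then show "s \<in> W"
    by (induct s rule: ideal_prod.induct) (auto intro: IJ V.subspaceD(3)[OF W])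
qed

section \<open>Residue field, units and Nakayama's lemma\<close>

text \<open>Surjectivity of the structure map onto \<open>A/m\<close>: the residue class of
  \<open>x\<close> is represented by a scalar.\<close>

lemma scalar_decomposition:
  assumes "x \<in> carrier A"
  obtains c y where "c \<in> carrier K" "y \<in> m" "x = c \<odot>\<^bsub>A\<^esub> \<one>\<^bsub>A\<^esub> \<oplus>\<^bsub>A\<^esub> y"
proof -
  have ms: "subspace K m A" by (rule ideal_subspace[OF m_ideal])
  have "m +>\<^bsub>A\<^esub> x \<in> carrier (A Quot m)"
    using assms by (auto simp: FactRing_def A_RCOSETS_def')
  moreover have "(\<lambda>c. m +>\<^bsub>A\<^esub> (c \<odot>\<^bsub>A\<^esub> \<one>\<^bsub>A\<^esub>)) ` carrier K = carrier (A Quot m)"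
    using residue_iso unfolding ring_iso_def bij_betw_def by blast
  ultimately have "m +>\<^bsub>A\<^esub> x \<in> (\<lambda>c. m +>\<^bsub>A\<^esub> (c \<odot>\<^bsub>A\<^esub> \<one>\<^bsub>A\<^esub>)) ` carrier K" by simp
  then obtain c where c: "c \<in> carrier K" "m +>\<^bsub>A\<^esub> x = m +>\<^bsub>A\<^esub> (c \<odot>\<^bsub>A\<^esub> \<one>\<^bsub>A\<^esub>)"
    by (elim imageE)
  have e: "x \<ominus>\<^bsub>A\<^esub> c \<odot>\<^bsub>A\<^esub> \<one>\<^bsub>A\<^esub> \<in> m"
    using V.coset_eq_iff[OF ms assms, of "c \<odot>\<^bsub>A\<^esub> \<one>\<^bsub>A\<^esub>"] c by simp
  have "x = c \<odot>\<^bsub>A\<^esub> \<one>\<^bsub>A\<^esub> \<oplus>\<^bsub>A\<^esub> (x \<ominus>\<^bsub>A\<^esub> c \<odot>\<^bsub>A\<^esub> \<one>\<^bsub>A\<^esub>)"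
    using assms c(1) by (simp add: minus_eq a_lcomm[of _ x] r_neg)
  then show thesis using that[OF c(1) e] by simp
qed

text \<open>Injectivity of the structure map onto \<open>A/m\<close>.\<close>

lemma scalar_in_m:
  assumes "c \<in> carrier K" "c \<odot>\<^bsub>A\<^esub> \<one>\<^bsub>A\<^esub> \<in> m"
  shows "c = \<zero>\<^bsub>K\<^esub>"
proof -
  have "m +>\<^bsub>A\<^esub> (c \<odot>\<^bsub>A\<^esub> \<one>\<^bsub>A\<^esub>) = m +>\<^bsub>A\<^esub> (\<zero>\<^bsub>K\<^esub> \<odot>\<^bsub>A\<^esub> \<one>\<^bsub>A\<^esub>)"
    using assms a_rcos_zero[OF m_ideal] V.subspaceD(2)[OF ideal_subspace[OF m_ideal]] by simp
  moreover have "inj_on (\<lambda>c. m +>\<^bsub>A\<^esub> (c \<odot>\<^bsub>A\<^esub> \<one>\<^bsub>A\<^esub>)) (carrier K)"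
    using residue_iso unfolding ring_iso_def bij_betw_def by blast
  ultimately show ?thesis using assms(1) by (metis (no_types, lifting) K.zero_closed inj_onD)
qed

lemma one_notin_m: "\<one>\<^bsub>A\<^esub> \<notin> m"
  using scalar_in_m[of "\<one>\<^bsub>K\<^esub>"] by auto

lemma principal_ideal: "x \<in> carrier A \<Longrightarrow> ideal (PIdl\<^bsub>A\<^esub> x) A"
  by (rule cgenideal_ideal)

text \<open>If \<open>1 - a\<close> generated a proper ideal, an ideal maximal among those
  containing it and omitting \<open>1\<close> would be a maximal ideal, hence \<open>m\<close>. Then
  \<open>1 - a\<close> and \<open>a\<close> both lie in \<open>m\<close>, and so does
  \<open>1\<close>.\<close>

lemma unit_one_minus:
  assumes a: "a \<in> m"
  shows "\<exists>b\<in>carrier A. b \<otimes>\<^bsub>A\<^esub> (\<one>\<^bsub>A\<^esub> \<ominus>\<^bsub>A\<^esub> a) = \<one>\<^bsub>A\<^esub>"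
proof -
  have ac: "a \<in> carrier A" using ideal.Icarr[OF m_ideal a] .
  let ?u = "\<one>\<^bsub>A\<^esub> \<ominus>\<^bsub>A\<^esub> a"
  have uc: "?u \<in> carrier A" using ac by simp
  let ?P = "\<lambda>J. ideal J A \<and> PIdl\<^bsub>A\<^esub> ?u \<subseteq> J \<and> \<one>\<^bsub>A\<^esub> \<notin> J"
  have "\<one>\<^bsub>A\<^esub> \<in> PIdl\<^bsub>A\<^esub> ?u"
  proof (rule ccontr)
    assume "\<one>\<^bsub>A\<^esub> \<notin> PIdl\<^bsub>A\<^esub> ?u"
    then have "?P (PIdl\<^bsub>A\<^esub> ?u)" using principal_ideal[OF uc] by blast
    then obtain J where J: "?P J" and mx: "\<And>J'. ?P J' \<Longrightarrow> J \<subseteq> J' \<Longrightarrow> J' = J"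
      by (rule V.maximal_subspace_exists[of ?P, OF fin_dim]) (use ideal_subspace in blast)+
    have "maximalideal J A"
    proof (rule maximalidealI)
      show "ideal J A" using J by blast
      show "carrier A \<noteq> J" using J one_closed by metis
      fix J' assume J': "ideal J' A" "J \<subseteq> J'" "J' \<subseteq> carrier A"
      show "J' = J \<or> J' = carrier A"
      proof (cases "\<one>\<^bsub>A\<^esub> \<in> J'")
        case True
        then show ?thesis using ideal.one_imp_carrier[OF J'(1)] by simp
      next
        case False
        then show ?thesis using mx[of J'] J J' by blast
      qed
    qed
    then have "J = m" by (rule unique_maximal)
    then have "?u \<in> m" using J cgenideal_self[OF uc] by blast
    then have "?u \<oplus>\<^bsub>A\<^esub> a \<in> m" using a V.subspaceD(3)[OF ideal_subspace[OF m_ideal]] by blast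
    moreover have "?u \<oplus>\<^bsub>A\<^esub> a = \<one>\<^bsub>A\<^esub>" using ac by (simp add: minus_eq a_assoc l_neg)
    ultimately show False using one_notin_m by simp
  qed
  then show ?thesis unfolding cgenideal_def by force
qed

text \<open>For nonzero \<open>I\<close> take a maximal proper subideal \<open>J\<close>. Then
  \<open>I/J\<close> is simple, so it is generated by the class of any \<open>x\<close> outside
  \<open>J\<close>, and \<open>m\<close> annihilates it. Hence \<open>I m\<close> lies in
  \<open>J\<close> and cannot be all of \<open>I\<close>.\<close>

lemma nakayama:
  assumes I: "ideal I A" and eq: "ideal_prod A I m = I"
  shows "I = {\<zero>\<^bsub>A\<^esub>}"
proof (rule ccontr)
  assume ne: "I \<noteq> {\<zero>\<^bsub>A\<^esub>}"
  let ?P = "\<lambda>J. ideal J A \<and> J \<subseteq> I \<and> J \<noteq> I"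
  note Is = V.subspaceD[OF ideal_subspace[OF I]]
  \<comment> \<open>The zero ideal is proper in \<open>I\<close> exactly because \<open>I\<close> is
    nonzero; this starts the search for \<open>J\<close>.\<close>
  have "?P {\<zero>\<^bsub>A\<^esub>}" using ne Is(2) zeroideal by auto
  then obtain J where J: "?P J" and mx: "\<And>J'. ?P J' \<Longrightarrow> J \<subseteq> J' \<Longrightarrow> J' = J"
    by (rule V.maximal_subspace_exists[of ?P, OF fin_dim]) (use ideal_subspace in blast)+
  have Ji: "ideal J A" using J by blast
  note Js = V.subspaceD[OF ideal_subspace[OF Ji]]
  obtain x where x: "x \<in> I" "x \<notin> J" using J by blast
  have gen: "J <+>\<^bsub>A\<^esub> PIdl\<^bsub>A\<^esub> y = I" if y: "y \<in> I" "y \<notin> J" for y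
  proof (rule ccontr)
    assume n: "J <+>\<^bsub>A\<^esub> PIdl\<^bsub>A\<^esub> y \<noteq> I"
    have yc: "y \<in> carrier A" using y Is(1) by blast
    have "PIdl\<^bsub>A\<^esub> y \<subseteq> I" by (rule cgenideal_minimal[OF I y(1)])
    then have "J <+>\<^bsub>A\<^esub> PIdl\<^bsub>A\<^esub> y \<subseteq> I"
      using J Is(3) unfolding set_add_def' by blast
    then have "?P (J <+>\<^bsub>A\<^esub> PIdl\<^bsub>A\<^esub> y)"
      using n add_ideals[OF Ji principal_ideal[OF yc]] by blast
    moreover have "J \<subseteq> J <+>\<^bsub>A\<^esub> PIdl\<^bsub>A\<^esub> y"
    proof
      fix j assume j: "j \<in> J"
      have "\<zero>\<^bsub>A\<^esub> \<in> PIdl\<^bsub>A\<^esub> y" using V.subspaceD(2)[OF ideal_subspace[OF principal_ideal[OF yc]]] .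
      moreover have "j = j \<oplus>\<^bsub>A\<^esub> \<zero>\<^bsub>A\<^esub>" using j Js(1) by auto
      ultimately show "j \<in> J <+>\<^bsub>A\<^esub> PIdl\<^bsub>A\<^esub> y" using j unfolding set_add_def' by blast
    qed
    ultimately have e: "J <+>\<^bsub>A\<^esub> PIdl\<^bsub>A\<^esub> y = J" by (rule mx)
    have "\<zero>\<^bsub>A\<^esub> \<oplus>\<^bsub>A\<^esub> y \<in> J <+>\<^bsub>A\<^esub> PIdl\<^bsub>A\<^esub> y"
      using Js(2) cgenideal_self[OF yc] unfolding set_add_def' by blast
    then show False using y(2) yc e by simp
  qed
  have xc: "x \<in> carrier A" using x Is(1) by blast
  have ax: "a \<otimes>\<^bsub>A\<^esub> x \<in> J" if a: "a \<in> m" for a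
  proof (rule ccontr)
    assume n: "a \<otimes>\<^bsub>A\<^esub> x \<notin> J"
    have ac: "a \<in> carrier A" using ideal.Icarr[OF m_ideal a] .
    have "a \<otimes>\<^bsub>A\<^esub> x \<in> I" using ideal.I_l_closed[OF I x(1) ac] .
    then have "x \<in> J <+>\<^bsub>A\<^esub> PIdl\<^bsub>A\<^esub> (a \<otimes>\<^bsub>A\<^esub> x)" using gen[OF _ n] x by blast
    then obtain j b where jb: "j \<in> J" "b \<in> carrier A" "x = j \<oplus>\<^bsub>A\<^esub> b \<otimes>\<^bsub>A\<^esub> (a \<otimes>\<^bsub>A\<^esub> x)"
      unfolding set_add_def' cgenideal_def by blast
    have jc: "j \<in> carrier A" using jb Js(1) by blast
    have ba: "b \<otimes>\<^bsub>A\<^esub> a \<in> m" using ideal.I_l_closed[OF m_ideal a jb(2)] .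
    obtain d where d: "d \<in> carrier A" "d \<otimes>\<^bsub>A\<^esub> (\<one>\<^bsub>A\<^esub> \<ominus>\<^bsub>A\<^esub> b \<otimes>\<^bsub>A\<^esub> a) = \<one>\<^bsub>A\<^esub>"
      using unit_one_minus[OF ba] by blast
    \<comment> \<open>The equation \<open>x = j + b a x\<close> reads
      \<open>(1 - b a) x = j\<close>. Since \<open>1 - b a\<close> is a unit, \<open>x\<close> would
      lie in \<open>J\<close>.\<close>
    have "(\<one>\<^bsub>A\<^esub> \<ominus>\<^bsub>A\<^esub> b \<otimes>\<^bsub>A\<^esub> a) \<otimes>\<^bsub>A\<^esub> x = x \<ominus>\<^bsub>A\<^esub> b \<otimes>\<^bsub>A\<^esub> (a \<otimes>\<^bsub>A\<^esub> x)"
      using ac jb(2) xc by (simp add: minus_eq l_distr l_minus m_assoc)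
    also have "\<dots> = j"
    proof -
      have bc: "b \<otimes>\<^bsub>A\<^esub> (a \<otimes>\<^bsub>A\<^esub> x) \<in> carrier A" using ac jb(2) xc by simp
      have "x \<ominus>\<^bsub>A\<^esub> b \<otimes>\<^bsub>A\<^esub> (a \<otimes>\<^bsub>A\<^esub> x) =
          (j \<oplus>\<^bsub>A\<^esub> b \<otimes>\<^bsub>A\<^esub> (a \<otimes>\<^bsub>A\<^esub> x)) \<ominus>\<^bsub>A\<^esub> b \<otimes>\<^bsub>A\<^esub> (a \<otimes>\<^bsub>A\<^esub> x)"
        using jb(3) by simp
      then show ?thesis using bc jc by (simp add: minus_eq a_assoc r_neg)
    qed
    finally have "d \<otimes>\<^bsub>A\<^esub> ((\<one>\<^bsub>A\<^esub> \<ominus>\<^bsub>A\<^esub> b \<otimes>\<^bsub>A\<^esub> a) \<otimes>\<^bsub>A\<^esub> x) \<in> J"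
      using ideal.I_l_closed[OF Ji jb(1) d(1)] by simp
    moreover have "d \<otimes>\<^bsub>A\<^esub> ((\<one>\<^bsub>A\<^esub> \<ominus>\<^bsub>A\<^esub> b \<otimes>\<^bsub>A\<^esub> a) \<otimes>\<^bsub>A\<^esub> x) = x"
      using d ac jb(2) xc m_assoc[of d "\<one>\<^bsub>A\<^esub> \<ominus>\<^bsub>A\<^esub> b \<otimes>\<^bsub>A\<^esub> a" x] by simp
    ultimately show False using x(2) by simp
  qed
  have "ideal_prod A I m \<subseteq> J"
  proof (rule ideal_prod_subset[OF ideal_subspace[OF Ji]])
    fix y a assume y: "y \<in> I" and a: "a \<in> m"
    have ac: "a \<in> carrier A" using ideal.Icarr[OF m_ideal a] .
    obtain j b where jb: "j \<in> J" "b \<in> carrier A" "y = j \<oplus>\<^bsub>A\<^esub> b \<otimes>\<^bsub>A\<^esub> x"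
      using y gen[OF x] unfolding set_add_def' cgenideal_def by blast
    have jc: "j \<in> carrier A" using jb Js(1) by blast
    have "y \<otimes>\<^bsub>A\<^esub> a = a \<otimes>\<^bsub>A\<^esub> j \<oplus>\<^bsub>A\<^esub> b \<otimes>\<^bsub>A\<^esub> (a \<otimes>\<^bsub>A\<^esub> x)"
      using jc jb ac xc by (simp add: r_distr m_ac)
    then show "y \<otimes>\<^bsub>A\<^esub> a \<in> J"
      using Js(3) ideal.I_l_closed[OF Ji] jb ac ax[OF a] by simp
  qed
  then show False using eq J by blast
qed

section \<open>Hilbert function and complements of consecutive powers\<close>

lemma sdim_mpow: "V.sdim (mpow i) = V.sdim (mpow (Suc i)) + hilbert_function K A m i"
proof -
  have "x \<ominus>\<^bsub>A\<^esub> x \<in> mpow (Suc i)" if "x \<in> mpow i" for x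
    using mpow_closed(2) mpow_carrier[OF that] by (simp add: minus_eq r_neg)
  then have "V.sdim (mpow i) = V.sdim (mpow i \<inter> mpow (Suc i)) + vectorspace.dim K (subquotient A (mpow i) (mpow (Suc i)))"
    by (intro V.sdim_subquotient[OF fin_dim mpow_subspace mpow_subspace mpow_subspace subset_refl]) blast
  moreover have "mpow i \<inter> mpow (Suc i) = mpow (Suc i)" using mpow_antimono[of i "Suc i"] by auto
  ultimately show ?thesis by (simp add: hilbert_function_def graded_piece_def mpow_def)
qed

text \<open>A vanishing value of the Hilbert function makes two consecutive powers of equal
  dimension, so \<open>m^i = m^i m\<close> and Nakayama's lemma applies.\<close>

lemma mpow_eq_zero:
  assumes "hilbert_function K A m i = 0"
  shows "mpow i = {\<zero>\<^bsub>A\<^esub>}"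
proof (rule nakayama[OF mpow_ideal])
  have "mpow (Suc i) = mpow i"
    by (rule V.subspace_eqI[OF fin_dim mpow_subspace mpow_subspace])
      (use mpow_antimono[of i "Suc i"] sdim_mpow[of i] assms in auto)
  then show "ideal_prod A (mpow i) m = mpow i" by (simp add: mpow_Suc)
qed

text \<open>Equivalently, \<open>C\<close> maps isomorphically onto the graded piece of degree
  \<open>i\<close>. Generation is stated elementwise because this is the form in which
  representatives are extracted.\<close>

definition is_complement :: "nat \<Rightarrow> 'a set \<Rightarrow> bool" where
  "is_complement i C \<longleftrightarrow> subspace K C A \<and> C \<subseteq> mpow i \<and> C \<inter> mpow (Suc i) = {\<zero>\<^bsub>A\<^esub>} \<and>
    (\<forall>x\<in>mpow i. \<exists>b\<in>C. x \<ominus>\<^bsub>A\<^esub> b \<in> mpow (Suc i))"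

lemma is_complementI:
  assumes "subspace K C A" "C \<subseteq> mpow i"
    and "\<And>x. x \<in> C \<Longrightarrow> x \<in> mpow (Suc i) \<Longrightarrow> x = \<zero>\<^bsub>A\<^esub>"
    and "\<And>x. x \<in> mpow i \<Longrightarrow> \<exists>b\<in>C. x \<ominus>\<^bsub>A\<^esub> b \<in> mpow (Suc i)"
  shows "is_complement i C"
  unfolding is_complement_def
  using assms V.subspaceD(2)[OF assms(1)] mpow_closed(2)[of "Suc i"] by blast

lemma is_complementD:
  assumes "is_complement i C"
  shows "subspace K C A" "C \<subseteq> mpow i" "C \<inter> mpow (Suc i) = {\<zero>\<^bsub>A\<^esub>}"
    and "\<And>x. x \<in> mpow i \<Longrightarrow> \<exists>b\<in>C. x \<ominus>\<^bsub>A\<^esub> b \<in> mpow (Suc i)"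
  using assms by (auto simp: is_complement_def)

end

section \<open>Gradings compatible with the powers of the maximal ideal\<close>

text \<open>Complements alone exist in every finite local algebra. \<open>B_mult\<close> is the
  substantial requirement: products lie in \<open>B (i + j)\<close> itself and not merely modulo the
  next power of \<open>m\<close>.\<close>

locale graded_splitting = finite_local_algebra K A m
  for K :: "('k, 'r) ring_scheme" (structure)
    and A :: "('k, 'a, 's) module_scheme" (structure)
    and m :: "'a set" +
  fixes B :: "nat \<Rightarrow> 'a set" and N :: nat
  assumes mpow_N: "mpow (Suc N) = {\<zero>\<^bsub>A\<^esub>}"
    and B_complement: "\<And>i. is_complement i (B i)"
    and B_mult: "\<And>i j x y. x \<in> B i \<Longrightarrow> y \<in> B j \<Longrightarrow> x \<otimes>\<^bsub>A\<^esub> y \<in> B (i + j)"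
    and B_one: "\<one>\<^bsub>A\<^esub> \<in> B 0"
begin

lemmas B_subspace = is_complementD(1)[OF B_complement]
lemmas B_mpow = is_complementD(2)[OF B_complement]
lemmas B_Int = is_complementD(3)[OF B_complement]
lemmas B_gen = is_complementD(4)[OF B_complement]
lemmas B_closed = V.subspaceD[OF B_subspace]

lemma B_carrier: "x \<in> B i \<Longrightarrow> x \<in> carrier A"
  using B_closed(1) by blast

lemma mpow_above: "N < i \<Longrightarrow> mpow i = {\<zero>\<^bsub>A\<^esub>}"
  using mpow_antimono[of "Suc N" i] mpow_N mpow_closed(2)[of i] by auto

lemma B_above: "N < i \<Longrightarrow> x \<in> B i \<Longrightarrow> x = \<zero>\<^bsub>A\<^esub>"
  using B_mpow[of i] mpow_above[of i] by auto

lemma finsum_subspace: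
  assumes W: "subspace K W A" and f: "\<And>i. i \<in> S \<Longrightarrow> f i \<in> W"
  shows "(\<Oplus>\<^bsub>A\<^esub>i\<in>S. f i) \<in> W"
  using f
proof (induct S rule: infinite_finite_induct)
  case (insert i S)
  have "f ` insert i S \<subseteq> carrier A" using insert.prems V.subspaceD(1)[OF W] by blast
  then have "f \<in> S \<rightarrow> carrier A" "f i \<in> carrier A" by auto
  then have "(\<Oplus>\<^bsub>A\<^esub>i\<in>insert i S. f i) = f i \<oplus>\<^bsub>A\<^esub> (\<Oplus>\<^bsub>A\<^esub>i\<in>S. f i)"
    using insert.hyps by simp
  then show ?case using insert V.subspaceD(3)[OF W] by simp
qed (use V.subspaceD(2)[OF W] in auto)

section \<open>Homogeneous components of an element\<close>

text \<open>\<open>b\<close> is a sequence over all degrees while the sum stops at \<open>N\<close>.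
  Nothing is left undetermined, since \<open>B_above\<close> forces the later entries to be
  zero.\<close>

definition components :: "'a \<Rightarrow> (nat \<Rightarrow> 'a) \<Rightarrow> bool" where
  "components x b \<longleftrightarrow> (\<forall>i. b i \<in> B i) \<and> x = (\<Oplus>\<^bsub>A\<^esub>i\<in>{..N}. b i)"

lemma components_mem: "components x b \<Longrightarrow> b i \<in> B i"
  by (simp add: components_def)

lemma components_carrier: "components x b \<Longrightarrow> b i \<in> carrier A"
  using components_mem B_carrier by blast

text \<open>The term of index \<open>k\<close> is replaced by zero and not removed, so that the
  remaining sum keeps the index set \<open>{..N}\<close> and can be compared termwise.\<close>

lemma finsum_split:
  assumes b: "\<And>i. b i \<in> carrier A" and k: "k \<le> N"
  shows "(\<Oplus>\<^bsub>A\<^esub>i\<in>{..N}. b i) = b k \<oplus>\<^bsub>A\<^esub> (\<Oplus>\<^bsub>A\<^esub>i\<in>{..N}. if i = k then \<zero>\<^bsub>A\<^esub> else b i)"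
proof -
  have "(\<Oplus>\<^bsub>A\<^esub>i\<in>{..N}. if k = i then b i else \<zero>\<^bsub>A\<^esub>) = b k"
    by (rule finsum_singleton) (use k b in auto)
  moreover have "(\<Oplus>\<^bsub>A\<^esub>i\<in>{..N}. b i) =
      (\<Oplus>\<^bsub>A\<^esub>i\<in>{..N}. (if k = i then b i else \<zero>\<^bsub>A\<^esub>) \<oplus>\<^bsub>A\<^esub> (if i = k then \<zero>\<^bsub>A\<^esub> else b i))"
    by (rule finsum_cong') (use b in auto)
  moreover have "\<dots> = (\<Oplus>\<^bsub>A\<^esub>i\<in>{..N}. if k = i then b i else \<zero>\<^bsub>A\<^esub>) \<oplus>\<^bsub>A\<^esub>
      (\<Oplus>\<^bsub>A\<^esub>i\<in>{..N}. if i = k then \<zero>\<^bsub>A\<^esub> else b i)"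
    by (rule finsum_addf) (use b in auto)
  ultimately show ?thesis by simp
qed

text \<open>Descending induction on \<open>k\<close>, starting from \<open>m^(N+1) = 0\<close>: a
  representative in \<open>B k\<close> is split off and the rest lies in the next power. The
  vanishing below \<open>k\<close> is carried along to keep slot \<open>k\<close> free in the
  inductive step.\<close>

lemma components_exists_above:
  assumes "k \<le> Suc N" "x \<in> mpow k"
  shows "\<exists>b. components x b \<and> (\<forall>i<k. b i = \<zero>\<^bsub>A\<^esub>)"
  using assms
proof (induct k arbitrary: x rule: inc_induct)
  case base
  then have "components x (\<lambda>_. \<zero>\<^bsub>A\<^esub>)" using mpow_N B_closed(2) by (simp add: components_def)
  then show ?case by blast
next
  case (step k)
  obtain b0 where b0: "b0 \<in> B k" "x \<ominus>\<^bsub>A\<^esub> b0 \<in> mpow (Suc k)" using B_gen step.prems by blast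
  obtain b where b: "components (x \<ominus>\<^bsub>A\<^esub> b0) b" "\<forall>i<Suc k. b i = \<zero>\<^bsub>A\<^esub>" using step.hyps(3)[OF b0(2)] by blast
  \<comment> \<open>The entry \<open>b k\<close> is zero by the induction hypothesis, so overwriting
    it adds exactly \<open>b0\<close> to the sum.\<close>
  let ?b = "b(k := b0)"
  have c: "b0 \<in> carrier A" "x \<in> carrier A" using B_carrier b0 mpow_carrier step.prems by auto
  have B: "?b i \<in> B i" for i using b0(1) components_mem[OF b(1)] by simp
  have "(\<Oplus>\<^bsub>A\<^esub>i\<in>{..N}. ?b i) = b0 \<oplus>\<^bsub>A\<^esub> (\<Oplus>\<^bsub>A\<^esub>i\<in>{..N}. if i = k then \<zero>\<^bsub>A\<^esub> else ?b i)"
    using finsum_split[of ?b k] B_carrier[OF B] step.hyps by simp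
  also have "(\<Oplus>\<^bsub>A\<^esub>i\<in>{..N}. if i = k then \<zero>\<^bsub>A\<^esub> else ?b i) = (\<Oplus>\<^bsub>A\<^esub>i\<in>{..N}. b i)"
    by (rule finsum_cong') (use b(2) components_carrier[OF b(1)] in auto)
  also have "\<dots> = x \<ominus>\<^bsub>A\<^esub> b0" using b(1) by (simp add: components_def)
  also have "b0 \<oplus>\<^bsub>A\<^esub> (x \<ominus>\<^bsub>A\<^esub> b0) = x" using c by (simp add: minus_eq a_lcomm[of _ x] r_neg)
  finally have "components x ?b" using B by (simp add: components_def)
  moreover have "\<forall>i<k. ?b i = \<zero>\<^bsub>A\<^esub>" using b(2) by simp
  ultimately show ?case by blast
qed

lemma components_exists: "x \<in> carrier A \<Longrightarrow> \<exists>b. components x b"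
  using components_exists_above[of 0 x] by auto

text \<open>Look at the lowest degree: entries below \<open>k\<close> vanish by induction and those
  above lie in \<open>m^(k+1)\<close>. Hence \<open>b k\<close> lies in \<open>m^(k+1)\<close> as
  well, where \<open>B k\<close> contains only zero.\<close>

lemma components_zero:
  assumes "components \<zero>\<^bsub>A\<^esub> b"
  shows "b i = \<zero>\<^bsub>A\<^esub>"
proof (induct i rule: less_induct)
  case (less k)
  show ?case
  proof (cases "k \<le> N")
    case True
    let ?r = "\<Oplus>\<^bsub>A\<^esub>i\<in>{..N}. if i = k then \<zero>\<^bsub>A\<^esub> else b i"
    have "(if i = k then \<zero>\<^bsub>A\<^esub> else b i) \<in> mpow (Suc k)" for i
    proof (cases "i \<le> k")
      case True
      then show ?thesis using less[of i] mpow_closed(2)[of "Suc k"] by auto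
    next
      case False
      then show ?thesis using components_mem[OF assms, of i] B_mpow[of i] mpow_antimono[of "Suc k" i] by auto
    qed
    then have r: "?r \<in> mpow (Suc k)" by (intro finsum_subspace[OF mpow_subspace])
    have "b k \<oplus>\<^bsub>A\<^esub> ?r = \<zero>\<^bsub>A\<^esub>"
      using assms finsum_split[OF components_carrier[OF assms] True] by (simp add: components_def)
    then have "\<ominus>\<^bsub>A\<^esub> ?r = b k" using minus_equality mpow_carrier[OF r] components_carrier[OF assms] by blast
    then have "b k \<in> mpow (Suc k)" using mpow_closed(5)[OF r] by simp
    then show ?thesis using B_Int[of k] components_mem[OF assms, of k] by auto
  next
    case False
    then show ?thesis using B_above[of k] components_mem[OF assms] by simp
  qed
qed

lemma components_add:
  assumes "components x b" "components y c"
  shows "components (x \<oplus>\<^bsub>A\<^esub> y) (\<lambda>i. b i \<oplus>\<^bsub>A\<^esub> c i)"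
  using assms B_closed(3) finsum_addf[of b "{..N}" c] components_carrier[OF assms(1)] components_carrier[OF assms(2)]
  by (simp add: components_def)

lemma components_smult:
  assumes "components x b" "a \<in> carrier K"
  shows "components (a \<odot>\<^bsub>A\<^esub> x) (\<lambda>i. a \<odot>\<^bsub>A\<^esub> b i)"
  using assms B_closed(4) finsum_smult[of a b "{..N}"] components_carrier[OF assms(1)]
  by (simp add: components_def)

lemma components_unique:
  assumes "components x b" "components x c"
  shows "b = c"
proof
  fix i
  have xc: "x \<in> carrier A" using assms(1) components_carrier[OF assms(1)] by (simp add: components_def)
  have 1: "(\<ominus>\<^bsub>K\<^esub> \<one>\<^bsub>K\<^esub>) \<odot>\<^bsub>A\<^esub> z = \<ominus>\<^bsub>A\<^esub> z" if "z \<in> carrier A" for z using smult_minus_1[OF that] .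
  \<comment> \<open>The difference is formed with the scalar \<open>-1\<close>, so that
    \<open>components_add\<close> and \<open>components_smult\<close> suffice.\<close>
  have "components (x \<oplus>\<^bsub>A\<^esub> (\<ominus>\<^bsub>K\<^esub> \<one>\<^bsub>K\<^esub>) \<odot>\<^bsub>A\<^esub> x) (\<lambda>i. b i \<oplus>\<^bsub>A\<^esub> (\<ominus>\<^bsub>K\<^esub> \<one>\<^bsub>K\<^esub>) \<odot>\<^bsub>A\<^esub> c i)"
    by (intro components_add components_smult assms) simp
  then have "components \<zero>\<^bsub>A\<^esub> (\<lambda>i. b i \<oplus>\<^bsub>A\<^esub> (\<ominus>\<^bsub>K\<^esub> \<one>\<^bsub>K\<^esub>) \<odot>\<^bsub>A\<^esub> c i)" using 1[OF xc] xc by (simp add: r_neg)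
  then have "b i \<oplus>\<^bsub>A\<^esub> (\<ominus>\<^bsub>K\<^esub> \<one>\<^bsub>K\<^esub>) \<odot>\<^bsub>A\<^esub> c i = \<zero>\<^bsub>A\<^esub>" by (rule components_zero)
  then have "b i \<ominus>\<^bsub>A\<^esub> c i = \<zero>\<^bsub>A\<^esub>" using 1[OF components_carrier[OF assms(2)]] by (simp add: minus_eq)
  then show "b i = c i" using components_carrier[OF assms(1)] components_carrier[OF assms(2)] by simp
qed

lemma components_one: "components \<one>\<^bsub>A\<^esub> (\<lambda>i. if i = 0 then \<one>\<^bsub>A\<^esub> else \<zero>\<^bsub>A\<^esub>)"
proof -
  have "(\<Oplus>\<^bsub>A\<^esub>i\<in>{..N}. if 0 = i then \<one>\<^bsub>A\<^esub> else \<zero>\<^bsub>A\<^esub>) = \<one>\<^bsub>A\<^esub>"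
    using finsum_singleton[of 0 "{..N}" "\<lambda>_. \<one>\<^bsub>A\<^esub>"] by simp
  then show ?thesis using B_one B_closed(2) by (auto simp: components_def eq_commute)
qed

text \<open>The Cauchy product of the two sums runs up to degree \<open>N + N\<close>; by
  \<open>B_mult\<close> its terms lie in the right pieces, and those beyond \<open>N\<close> are
  zero.\<close>

lemma components_mult:
  assumes "components x b" "components y c"
  shows "components (x \<otimes>\<^bsub>A\<^esub> y) (\<lambda>k. \<Oplus>\<^bsub>A\<^esub>i\<in>{..k}. b i \<otimes>\<^bsub>A\<^esub> c (k - i))"
proof -
  let ?d = "\<lambda>k. \<Oplus>\<^bsub>A\<^esub>i\<in>{..k}. b i \<otimes>\<^bsub>A\<^esub> c (k - i)"
  have B: "?d k \<in> B k" for k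
  proof (rule finsum_subspace[OF B_subspace])
    show "b i \<otimes>\<^bsub>A\<^esub> c (k - i) \<in> B k" if "i \<in> {..k}" for i
      using B_mult[OF components_mem[OF assms(1), of i] components_mem[OF assms(2), of "k - i"]] that by simp
  qed
  have "(\<Oplus>\<^bsub>A\<^esub>k\<in>{..N + N}. ?d k) = (\<Oplus>\<^bsub>A\<^esub>i\<in>{..N}. b i) \<otimes>\<^bsub>A\<^esub> (\<Oplus>\<^bsub>A\<^esub>i\<in>{..N}. c i)"
    by (rule cauchy_product)
      (use B_above components_mem[OF assms(1)] components_mem[OF assms(2)] components_carrier[OF assms(1)] components_carrier[OF assms(2)] in auto)
  moreover have "(\<Oplus>\<^bsub>A\<^esub>k\<in>{..N}. ?d k) = (\<Oplus>\<^bsub>A\<^esub>k\<in>{..N + N}. ?d k)"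
    by (rule add.finprod_mono_neutral_cong_left) (use B_above[OF _ B] B_carrier[OF B] in auto)
  ultimately show ?thesis using B assms by (simp add: components_def)
qed

section \<open>Arithmetic in the graded pieces and the isomorphism with \<open>gr A\<close>\<close>

abbreviation gp :: "nat \<Rightarrow> ('k, 'a set) module" where
  "gp \<equiv> graded_piece A m"

abbreviation cs :: "nat \<Rightarrow> 'a \<Rightarrow> 'a set" where
  "cs i x \<equiv> mpow (Suc i) +>\<^bsub>A\<^esub> x"

lemma gp_eq: "gp i = subquotient A (mpow i) (mpow (Suc i))"
  by (simp add: graded_piece_def mpow_def)

lemma gp_carrier: "carrier (gp i) = cs i ` mpow i"
  by (simp add: gp_eq V.subquotient_carrier)

lemma gp_zero: "\<zero>\<^bsub>gp i\<^esub> = mpow (Suc i)"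
  by (simp add: gp_eq)

lemma gp_add:
  assumes "x \<in> carrier A" "y \<in> carrier A"
  shows "cs i x \<oplus>\<^bsub>gp i\<^esub> cs i y = cs i (x \<oplus>\<^bsub>A\<^esub> y)"
  using V.coset_add[OF mpow_subspace assms] by (simp add: gp_eq)

lemma gp_smult:
  assumes "x \<in> carrier A" "c \<in> carrier K"
  shows "c \<odot>\<^bsub>gp i\<^esub> cs i x = cs i (c \<odot>\<^bsub>A\<^esub> x)"
  using V.coset_smult[OF mpow_subspace assms] by (simp add: gp_eq)

lemma gp_vectorspace: "vectorspace K (gp k)"
  unfolding gp_eq by (rule V.subquotient_vectorspace[OF mpow_subspace mpow_subspace])

lemma gp_finsum:
  assumes "finite S" "\<And>i. i \<in> S \<Longrightarrow> f i \<in> mpow k"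
  shows "(\<Oplus>\<^bsub>gp k\<^esub>i\<in>S. cs k (f i)) = cs k (\<Oplus>\<^bsub>A\<^esub>i\<in>S. f i)"
proof -
  interpret gp: vectorspace K "gp k"
    by (rule gp_vectorspace)
  show ?thesis using assms
  proof (induct S rule: finite_induct)
    case empty
    then show ?case using V.coset_zero[OF mpow_subspace] by (simp add: gp_zero)
  next
    case (insert i S)
    have c: "f \<in> S \<rightarrow> carrier A" "f i \<in> carrier A" using insert.prems mpow_carrier by auto
    have "(\<Oplus>\<^bsub>gp k\<^esub>i\<in>insert i S. cs k (f i)) = cs k (f i) \<oplus>\<^bsub>gp k\<^esub> (\<Oplus>\<^bsub>gp k\<^esub>i\<in>S. cs k (f i))"
      using insert.hyps insert.prems by (intro gp.M.finsum_insert) (auto simp: gp_carrier)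
    also have "\<dots> = cs k (f i \<oplus>\<^bsub>A\<^esub> (\<Oplus>\<^bsub>A\<^esub>i\<in>S. f i))"
      using insert gp_add[OF c(2), of "\<Oplus>\<^bsub>A\<^esub>i\<in>S. f i"] c by simp
    finally show ?case using insert.hyps c by simp
  qed
qed

text \<open>Independence of representatives: \<open>x' y' - x y = x' (y' - y) + (x' - x) y\<close>,
  and each summand has one factor a power deeper than required. The union that defines
  \<open>rcoset_mult\<close> is therefore constant.\<close>

lemma rcoset_mult_cs:
  assumes x: "x \<in> mpow i" and y: "y \<in> mpow j"
  shows "rcoset_mult A (mpow (Suc (i + j))) (cs i x) (cs j y) = cs (i + j) (x \<otimes>\<^bsub>A\<^esub> y)"
proof -
  note c = mpow_carrier[OF x] mpow_carrier[OF y]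
  have "cs (i + j) (x' \<otimes>\<^bsub>A\<^esub> y') = cs (i + j) (x \<otimes>\<^bsub>A\<^esub> y)" if "x' \<in> cs i x" "y' \<in> cs j y" for x' y'
  proof -
    note x' = V.coset_memD[OF mpow_subspace c(1) that(1)]
    note y' = V.coset_memD[OF mpow_subspace c(2) that(2)]
    have "x' = (x' \<ominus>\<^bsub>A\<^esub> x) \<oplus>\<^bsub>A\<^esub> x" using x'(1) c by (simp add: minus_eq a_assoc l_neg)
    then have "x' \<in> mpow i"
      using mpow_closed(3)[OF _ x, of "x' \<ominus>\<^bsub>A\<^esub> x"] x'(2) mpow_antimono[of i "Suc i"] by auto
    then have "x' \<otimes>\<^bsub>A\<^esub> (y' \<ominus>\<^bsub>A\<^esub> y) \<in> mpow (Suc (i + j))"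
      using mpow_mult_mem[of x' i "y' \<ominus>\<^bsub>A\<^esub> y" "Suc j"] y'(2) by simp
    moreover have "(x' \<ominus>\<^bsub>A\<^esub> x) \<otimes>\<^bsub>A\<^esub> y \<in> mpow (Suc (i + j))"
      using mpow_mult_mem[of "x' \<ominus>\<^bsub>A\<^esub> x" "Suc i" y j] x'(2) y by simp
    ultimately have "x' \<otimes>\<^bsub>A\<^esub> (y' \<ominus>\<^bsub>A\<^esub> y) \<oplus>\<^bsub>A\<^esub> (x' \<ominus>\<^bsub>A\<^esub> x) \<otimes>\<^bsub>A\<^esub> y \<in> mpow (Suc (i + j))"
      by (rule mpow_closed(3))
    moreover have "x' \<otimes>\<^bsub>A\<^esub> (y' \<ominus>\<^bsub>A\<^esub> y) \<oplus>\<^bsub>A\<^esub> (x' \<ominus>\<^bsub>A\<^esub> x) \<otimes>\<^bsub>A\<^esub> y = x' \<otimes>\<^bsub>A\<^esub> y' \<ominus>\<^bsub>A\<^esub> x \<otimes>\<^bsub>A\<^esub> y"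
    proof -
      have "x' \<otimes>\<^bsub>A\<^esub> (y' \<ominus>\<^bsub>A\<^esub> y) \<oplus>\<^bsub>A\<^esub> (x' \<ominus>\<^bsub>A\<^esub> x) \<otimes>\<^bsub>A\<^esub> y =
          x' \<otimes>\<^bsub>A\<^esub> y' \<oplus>\<^bsub>A\<^esub> (\<ominus>\<^bsub>A\<^esub> (x' \<otimes>\<^bsub>A\<^esub> y) \<oplus>\<^bsub>A\<^esub> (x' \<otimes>\<^bsub>A\<^esub> y \<oplus>\<^bsub>A\<^esub> \<ominus>\<^bsub>A\<^esub> (x \<otimes>\<^bsub>A\<^esub> y)))"
        using x'(1) y'(1) c by (simp add: minus_eq l_distr r_distr l_minus r_minus a_assoc)
      then show ?thesis using x'(1) y'(1) c by (simp add: minus_eq r_neg1)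
    qed
    ultimately show ?thesis using V.coset_eq_iff[OF mpow_subspace] x'(1) y'(1) c by simp
  qed
  then have "rcoset_mult A (mpow (Suc (i + j))) (cs i x) (cs j y) =
      (\<Union>x'\<in>cs i x. \<Union>y'\<in>cs j y. cs (i + j) (x \<otimes>\<^bsub>A\<^esub> y))"
    unfolding rcoset_mult_def by (intro SUP_cong refl) blast
  also have "\<dots> = cs (i + j) (x \<otimes>\<^bsub>A\<^esub> y)"
  proof -
    have "cs i x \<noteq> {}" "cs j y \<noteq> {}" using V.coset_self[OF mpow_subspace] c by blast+
    then show ?thesis by (simp del: UN_simps)
  qed
  finally show ?thesis .
qed

text \<open>Each element goes to the classes of its homogeneous components. Since \<open>B i\<close>
  represents every class of degree \<open>i\<close> exactly once, this is bijective; the product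
  formula for components is the convolution that defines multiplication in
  \<open>associated_graded\<close>.\<close>

theorem algebra_iso_associated_graded: "algebra_iso K A (associated_graded A m) \<noteq> {}"
proof -
  let ?G = "associated_graded A m"
  obtain cp where cp: "\<And>x. x \<in> carrier A \<Longrightarrow> components x (cp x)"
    using components_exists by metis
  let ?f = "\<lambda>x i. cs i (cp x i)"
  have cpc: "cp x i \<in> carrier A" "cp x i \<in> mpow i" if "x \<in> carrier A" for x i
    using components_carrier[OF cp[OF that]] components_mem[OF cp[OF that], of i] B_mpow[of i] by auto
  have closed: "?f x \<in> carrier ?G" if "x \<in> carrier A" for x
  proof -
    have "i \<le> N" if "cs i (cp x i) \<noteq> mpow (Suc i)" for i
    proof (rule ccontr)
      assume "\<not> i \<le> N"
      then have "cp x i = \<zero>\<^bsub>A\<^esub>" using B_above[of i] components_mem[OF cp[OF \<open>x \<in> carrier A\<close>]] by simp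
      then show False using that V.coset_zero[OF mpow_subspace] by simp
    qed
    then have "finite {i. cs i (cp x i) \<noteq> mpow (Suc i)}"
      by (rule_tac finite_subset[of _ "{..N}"]) auto
    then show ?thesis using cpc(2)[OF that] by (simp add: associated_graded_def gp_carrier gp_zero)
  qed
  have add: "?f (x \<oplus>\<^bsub>A\<^esub> y) = ?f x \<oplus>\<^bsub>?G\<^esub> ?f y" if "x \<in> carrier A" "y \<in> carrier A" for x y
  proof -
    have "cp (x \<oplus>\<^bsub>A\<^esub> y) = (\<lambda>i. cp x i \<oplus>\<^bsub>A\<^esub> cp y i)"
      by (rule components_unique[OF cp components_add[OF cp cp]]) (use that in auto)
    then show ?thesis using cpc that by (simp add: associated_graded_def gp_add)
  qed
  have smult: "?f (c \<odot>\<^bsub>A\<^esub> x) = c \<odot>\<^bsub>?G\<^esub> ?f x" if "c \<in> carrier K" "x \<in> carrier A" for c x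
  proof -
    have "cp (c \<odot>\<^bsub>A\<^esub> x) = (\<lambda>i. c \<odot>\<^bsub>A\<^esub> cp x i)"
      by (rule components_unique[OF cp components_smult[OF cp]]) (use that in auto)
    then show ?thesis using cpc that by (simp add: associated_graded_def gp_smult)
  qed
  have mult: "?f (x \<otimes>\<^bsub>A\<^esub> y) = ?f x \<otimes>\<^bsub>?G\<^esub> ?f y" if "x \<in> carrier A" "y \<in> carrier A" for x y
  proof
    fix k
    have mem: "cp x i \<otimes>\<^bsub>A\<^esub> cp y (k - i) \<in> mpow k" if "i \<le> k" for i
      using mpow_mult_mem[of "cp x i" i "cp y (k - i)" "k - i"] cpc(2) that \<open>x \<in> carrier A\<close> \<open>y \<in> carrier A\<close>
      by simp
    have "cp (x \<otimes>\<^bsub>A\<^esub> y) = (\<lambda>k. \<Oplus>\<^bsub>A\<^esub>i\<in>{..k}. cp x i \<otimes>\<^bsub>A\<^esub> cp y (k - i))"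
      by (rule components_unique[OF cp components_mult[OF cp cp]]) (use that in auto)
    then have "?f (x \<otimes>\<^bsub>A\<^esub> y) k = cs k (\<Oplus>\<^bsub>A\<^esub>i\<in>{..k}. cp x i \<otimes>\<^bsub>A\<^esub> cp y (k - i))" by simp
    also have "\<dots> = (\<Oplus>\<^bsub>gp k\<^esub>i\<in>{..k}. cs k (cp x i \<otimes>\<^bsub>A\<^esub> cp y (k - i)))"
      by (rule gp_finsum[symmetric])
        (use mem in auto)
    also have "\<dots> = (\<Oplus>\<^bsub>gp k\<^esub>i\<in>{..k}. rcoset_mult A (mpow (Suc k)) (?f x i) (?f y (k - i)))"
    proof -
      interpret gp: vectorspace K "gp k" by (rule gp_vectorspace)
      have "rcoset_mult A (mpow (Suc k)) (?f x i) (?f y (k - i)) = cs k (cp x i \<otimes>\<^bsub>A\<^esub> cp y (k - i))" if "i \<le> k" for i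
        using rcoset_mult_cs[of "cp x i" i "cp y (k - i)" "k - i"] cpc(2) that \<open>x \<in> carrier A\<close> \<open>y \<in> carrier A\<close>
        by simp
      then show ?thesis by (intro gp.M.finsum_cong') (use mem in \<open>auto simp: gp_carrier\<close>)
    qed
    finally show "?f (x \<otimes>\<^bsub>A\<^esub> y) k = (?f x \<otimes>\<^bsub>?G\<^esub> ?f y) k"
      by (simp add: associated_graded_def mpow_def)
  qed
  have one: "?f \<one>\<^bsub>A\<^esub> = \<one>\<^bsub>?G\<^esub>"
  proof -
    have "cp \<one>\<^bsub>A\<^esub> = (\<lambda>i. if i = 0 then \<one>\<^bsub>A\<^esub> else \<zero>\<^bsub>A\<^esub>)"
      by (rule components_unique[OF cp components_one]) simp
    then show ?thesis by (simp add: associated_graded_def mpow_def)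
  qed
  have "inj_on ?f (carrier A)"
  proof (rule inj_onI)
    fix x y assume x: "x \<in> carrier A" and y: "y \<in> carrier A" and eq: "?f x = ?f y"
    have "cp x i = cp y i" for i
    proof -
      have "cp x i \<ominus>\<^bsub>A\<^esub> cp y i \<in> mpow (Suc i)"
        using V.coset_eq_iff[OF mpow_subspace cpc(1)[OF x] cpc(1)[OF y]] fun_cong[OF eq] by blast
      moreover have "cp x i \<ominus>\<^bsub>A\<^esub> cp y i \<in> B i"
        by (rule B_closed(6)[OF components_mem[OF cp[OF x]] components_mem[OF cp[OF y]]])
      ultimately have "cp x i \<ominus>\<^bsub>A\<^esub> cp y i = \<zero>\<^bsub>A\<^esub>" using B_Int by blast
      then show ?thesis using cpc(1)[OF x] cpc(1)[OF y] by simp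
    qed
    then have "cp x = cp y" by (rule ext)
    then show "x = y" using cp[OF x] cp[OF y] by (simp add: components_def)
  qed
  moreover have "?f ` carrier A = carrier ?G"
  proof (intro equalityI subsetI)
    fix g assume "g \<in> carrier ?G"
    then have "\<forall>i. \<exists>z\<in>mpow i. g i = cs i z" by (auto simp: associated_graded_def gp_carrier)
    then obtain z where z: "\<And>i. z i \<in> mpow i" "\<And>i. g i = cs i (z i)" by metis
    have "\<forall>i. \<exists>b\<in>B i. z i \<ominus>\<^bsub>A\<^esub> b \<in> mpow (Suc i)" using B_gen z(1) by blast
    then obtain b where b: "\<And>i. b i \<in> B i" "\<And>i. z i \<ominus>\<^bsub>A\<^esub> b i \<in> mpow (Suc i)" by metis
    \<comment> \<open>Each class of \<open>g\<close> is moved to its representative in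
      \<open>B i\<close>; the sum of these representatives is the preimage of
      \<open>g\<close>.\<close>
    have g: "g i = cs i (b i)" for i
      using V.coset_eq_iff[OF mpow_subspace mpow_carrier[OF z(1)] B_carrier[OF b(1)]] b(2) z(2) by simp
    let ?x = "\<Oplus>\<^bsub>A\<^esub>i\<in>{..N}. b i"
    have x: "?x \<in> carrier A" by (rule finsum_closed) (use B_carrier[OF b(1)] in auto)
    have "cp ?x = b" by (rule components_unique[OF cp[OF x]]) (use b(1) in \<open>simp add: components_def\<close>)
    then have "g = ?f ?x" using g by auto
    then show "g \<in> ?f ` carrier A" using x by blast
  qed (use closed in blast)
  ultimately have "bij_betw ?f (carrier A) (carrier ?G)" by (simp add: bij_betw_def)
  then have "?f \<in> ring_iso A ?G"
    using closed mult add one by (intro ring_iso_memI)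
  moreover have "?f \<in> module_hom K A ?G"
    by (rule V.module_homI) (use closed add smult in blast)+
  ultimately show ?thesis unfolding algebra_iso_def by blast
qed

end

section \<open>Orthogonal complements in Gorenstein algebras\<close>

text \<open>The two conditions are injectivity and surjectivity of the map from \<open>A\<close> to
  its dual that sends \<open>a\<close> to \<open>lam (a _)\<close>; \<open>lam\<close> is a
  generator of the dual as an \<open>A\<close>-module.\<close>

locale nondegenerate_functional = finite_local_algebra K A m
  for K :: "('k, 'r) ring_scheme" (structure)
    and A :: "('k, 'a, 's) module_scheme" (structure)
    and m :: "'a set" +
  fixes lam :: "'a \<Rightarrow> 'k"
  assumes lam_hom: "lam \<in> module_hom K A (self_module K)"
    and nondegenerate: "\<And>a. a \<in> carrier A \<Longrightarrow> (\<And>x. x \<in> carrier A \<Longrightarrow> lam (a \<otimes>\<^bsub>A\<^esub> x) = \<zero>\<^bsub>K\<^esub>) \<Longrightarrow> a = \<zero>\<^bsub>A\<^esub>"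
    and representable: "\<And>f. f \<in> module_hom K A (self_module K) \<Longrightarrow>
      \<exists>a\<in>carrier A. \<forall>x\<in>carrier A. f x = lam (a \<otimes>\<^bsub>A\<^esub> x)"

text \<open>\<open>lam\<close> is the preimage of \<open>1\<close> under the isomorphism
  \<open>P\<close>. Because \<open>P\<close> is \<open>A\<close>-linear, the map taking
  \<open>a\<close> to \<open>lam (a _)\<close> is the inverse of \<open>P\<close>, hence
  bijective.\<close>

lemma (in finite_local_algebra) gorenstein_functional:
  assumes "gorenstein K A"
  obtains lam where "nondegenerate_functional K A m lam"
proof -
  let ?D = "dual_module K A"
  obtain P where P: "P \<in> module_hom A ?D (self_module A)"
    "bij_betw P (carrier ?D) (carrier A)"
    using assms by (auto simp: gorenstein_def module_iso_def self_module_def)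
  have "\<one>\<^bsub>A\<^esub> \<in> P ` carrier ?D" using P(2) by (simp add: bij_betw_def)
  then obtain lam where lam: "lam \<in> carrier ?D" "P lam = \<one>\<^bsub>A\<^esub>" by (metis imageE)
  have hom: "lam \<in> module_hom K A (self_module K)" using lam(1) by (simp add: dual_module_def)
  have P_act: "P (\<lambda>x\<in>carrier A. lam (a \<otimes>\<^bsub>A\<^esub> x)) = a" if "a \<in> carrier A" for a
  proof -
    have "P (a \<odot>\<^bsub>?D\<^esub> lam) = a \<otimes>\<^bsub>A\<^esub> P lam"
      using P(1) lam(1) that by (auto simp: module_hom_def self_module_def)
    then show ?thesis using lam(2) that by (simp add: dual_module_def)
  qed
  have inD: "(\<lambda>x\<in>carrier A. f x) \<in> carrier ?D" if "f \<in> module_hom K A (self_module K)" for f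
    using that by (auto simp: dual_module_def module_hom_def)
  have "nondegenerate_functional K A m lam"
  proof unfold_locales
    show "lam \<in> module_hom K A (self_module K)" by (rule hom)
  next
    fix a assume a: "a \<in> carrier A" and 0: "\<And>x. x \<in> carrier A \<Longrightarrow> lam (a \<otimes>\<^bsub>A\<^esub> x) = \<zero>\<^bsub>K\<^esub>"
    \<comment> \<open>The zero functional is written as \<open>lam (0 _)\<close>, so that
      \<open>P_act\<close> applies to both sides and returns \<open>a\<close> and
      \<open>0\<close>.\<close>
    have "lam (\<zero>\<^bsub>A\<^esub> \<otimes>\<^bsub>A\<^esub> x) = \<zero>\<^bsub>K\<^esub>" if "x \<in> carrier A" for x
      using 0[of "\<zero>\<^bsub>A\<^esub>"] a that by simp
    then have "(\<lambda>x\<in>carrier A. lam (a \<otimes>\<^bsub>A\<^esub> x)) = (\<lambda>x\<in>carrier A. lam (\<zero>\<^bsub>A\<^esub> \<otimes>\<^bsub>A\<^esub> x))"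
      using 0 by (intro restrict_ext) simp
    then have "P (\<lambda>x\<in>carrier A. lam (a \<otimes>\<^bsub>A\<^esub> x)) = P (\<lambda>x\<in>carrier A. lam (\<zero>\<^bsub>A\<^esub> \<otimes>\<^bsub>A\<^esub> x))"
      by (rule arg_cong)
    then show "a = \<zero>\<^bsub>A\<^esub>" unfolding P_act[OF a] P_act[OF zero_closed] .
  next
    fix f assume f: "f \<in> module_hom K A (self_module K)"
    let ?f = "\<lambda>x\<in>carrier A. f x"
    have a: "P ?f \<in> carrier A" using P(2) inD[OF f] by (auto simp: bij_betw_def)
    \<comment> \<open>The functional attached to \<open>P ?f\<close> has to be known to lie in the
      dual before injectivity of \<open>P\<close> can identify it with \<open>?f\<close>.\<close>
    have "(\<lambda>x. lam (P ?f \<otimes>\<^bsub>A\<^esub> x)) \<in> module_hom K A (self_module K)"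
    proof -
      have "lam (P ?f \<otimes>\<^bsub>A\<^esub> (c \<odot>\<^bsub>A\<^esub> x)) = c \<otimes>\<^bsub>K\<^esub> lam (P ?f \<otimes>\<^bsub>A\<^esub> x)" if "c \<in> carrier K" "x \<in> carrier A" for c x
      proof -
        have "P ?f \<otimes>\<^bsub>A\<^esub> (c \<odot>\<^bsub>A\<^esub> x) = c \<odot>\<^bsub>A\<^esub> (P ?f \<otimes>\<^bsub>A\<^esub> x)"
          using smult_assoc2[OF that a] that a m_comm[OF a] by simp
        then show ?thesis using hom that a by (auto simp: module_hom_def self_module_def)
      qed
      then show ?thesis using hom a by (auto simp: module_hom_def self_module_def r_distr Pi_def)
    qed
    then have eq: "(\<lambda>x\<in>carrier A. lam (P ?f \<otimes>\<^bsub>A\<^esub> x)) = ?f"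
      by (intro inj_onD[OF bij_betw_imp_inj_on[OF P(2)] P_act[OF a] inD inD[OF f]])
    have "\<forall>x\<in>carrier A. f x = lam (P ?f \<otimes>\<^bsub>A\<^esub> x)"
    proof
      fix x assume "x \<in> carrier A"
      then show "f x = lam (P ?f \<otimes>\<^bsub>A\<^esub> x)" using fun_cong[OF eq, of x] by (simp only: restrict_apply if_True)
    qed
    then show "\<exists>a\<in>carrier A. \<forall>x\<in>carrier A. f x = lam (a \<otimes>\<^bsub>A\<^esub> x)" using a by blast
  qed
  then show thesis by (rule that)
qed

context nondegenerate_functional
begin

lemma lam_closed [simp]: "x \<in> carrier A \<Longrightarrow> lam x \<in> carrier K"
  using lam_hom by (auto simp: module_hom_def self_module_def)

lemma lam_add: "x \<in> carrier A \<Longrightarrow> y \<in> carrier A \<Longrightarrow> lam (x \<oplus>\<^bsub>A\<^esub> y) = lam x \<oplus>\<^bsub>K\<^esub> lam y"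
  using lam_hom by (auto simp: module_hom_def self_module_def)

lemma lam_smult: "c \<in> carrier K \<Longrightarrow> x \<in> carrier A \<Longrightarrow> lam (c \<odot>\<^bsub>A\<^esub> x) = c \<otimes>\<^bsub>K\<^esub> lam x"
  using lam_hom by (auto simp: module_hom_def self_module_def)

lemma lam_zero: "lam \<zero>\<^bsub>A\<^esub> = \<zero>\<^bsub>K\<^esub>"
  using lam_smult[of "\<zero>\<^bsub>K\<^esub>" "\<zero>\<^bsub>A\<^esub>"] by simp

lemma lam_minus: "x \<in> carrier A \<Longrightarrow> lam (\<ominus>\<^bsub>A\<^esub> x) = \<ominus>\<^bsub>K\<^esub> lam x"
  using lam_add[of x "\<ominus>\<^bsub>A\<^esub> x"] lam_zero K.minus_equality[of "lam (\<ominus>\<^bsub>A\<^esub> x)" "lam x"]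
  by (simp add: r_neg K.a_comm)

lemma mult_smult:
  assumes "c \<in> carrier K" "x \<in> carrier A" "y \<in> carrier A"
  shows "x \<otimes>\<^bsub>A\<^esub> (c \<odot>\<^bsub>A\<^esub> y) = c \<odot>\<^bsub>A\<^esub> (x \<otimes>\<^bsub>A\<^esub> y)"
  using smult_assoc2[OF assms(1,3,2)] assms by (simp add: m_comm)

lemma subspace_lam_mult:
  assumes "subspace K W A" "a \<in> carrier A"
  shows "subspace K {x \<in> W. lam (a \<otimes>\<^bsub>A\<^esub> x) = \<zero>\<^bsub>K\<^esub>} A"
proof (rule V.subspaceI)
  note Ws = V.subspaceD[OF assms(1)]
  have c: "x \<in> carrier A" if "x \<in> W" for x using Ws(1) that by blast
  show "{x \<in> W. lam (a \<otimes>\<^bsub>A\<^esub> x) = \<zero>\<^bsub>K\<^esub>} \<subseteq> carrier A" using Ws(1) by blast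
  show "\<zero>\<^bsub>A\<^esub> \<in> {x \<in> W. lam (a \<otimes>\<^bsub>A\<^esub> x) = \<zero>\<^bsub>K\<^esub>}" using Ws(2) assms(2) lam_zero by simp
  show "x \<oplus>\<^bsub>A\<^esub> y \<in> {x \<in> W. lam (a \<otimes>\<^bsub>A\<^esub> x) = \<zero>\<^bsub>K\<^esub>}"
    if "x \<in> {x \<in> W. lam (a \<otimes>\<^bsub>A\<^esub> x) = \<zero>\<^bsub>K\<^esub>}" "y \<in> {x \<in> W. lam (a \<otimes>\<^bsub>A\<^esub> x) = \<zero>\<^bsub>K\<^esub>}" for x y
    using that c Ws(3) assms(2) by (simp add: r_distr lam_add)
  show "k \<odot>\<^bsub>A\<^esub> x \<in> {x \<in> W. lam (a \<otimes>\<^bsub>A\<^esub> x) = \<zero>\<^bsub>K\<^esub>}"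
    if "k \<in> carrier K" "x \<in> {x \<in> W. lam (a \<otimes>\<^bsub>A\<^esub> x) = \<zero>\<^bsub>K\<^esub>}" for k x
    using that c Ws(4) assms(2) by (simp add: mult_smult lam_smult)
qed

section \<open>Orthogonality and dimension\<close>

text \<open>The orthogonal space for the symmetric bilinear form \<open>lam (a x)\<close>, which
  \<open>nondegenerate\<close> makes nondegenerate.\<close>

definition orth :: "'a set \<Rightarrow> 'a set" where
  "orth W = {a \<in> carrier A. \<forall>x\<in>W. lam (a \<otimes>\<^bsub>A\<^esub> x) = \<zero>\<^bsub>K\<^esub>}"

lemma orth_subspace:
  assumes "W \<subseteq> carrier A"
  shows "subspace K (orth W) A"
proof (rule V.subspaceI)
  have c: "x \<in> carrier A" if "x \<in> W" for x using assms that by blast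
  show "orth W \<subseteq> carrier A" by (auto simp: orth_def)
  show "\<zero>\<^bsub>A\<^esub> \<in> orth W" using c lam_zero by (simp add: orth_def)
  show "x \<oplus>\<^bsub>A\<^esub> y \<in> orth W" if "x \<in> orth W" "y \<in> orth W" for x y
    using that c by (simp add: orth_def l_distr lam_add)
  show "k \<odot>\<^bsub>A\<^esub> x \<in> orth W" if "k \<in> carrier K" "x \<in> orth W" for k x
    using that c by (simp add: orth_def smult_assoc2 lam_smult)
qed

text \<open>\<open>orth D\<close> contains the kernel of an endomorphism of \<open>A\<close> with image in \<open>D\<close>.\<close>

lemma sdim_orth_ge:
  assumes D: "subspace K D A"
  shows "V.sdim (carrier A) \<le> V.sdim (orth D) + V.sdim D"
proof -
  obtain E where E: "finite E" "E \<subseteq> D" "lin_indpt E" "span E = D" "card E = V.sdim D"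
    using V.subspace_basis[OF fin_dim D] by blast
  have Dc: "D \<subseteq> carrier A" using V.subspaceD(1)[OF D] .
  have Ec: "E \<subseteq> carrier A" using E(2) Dc by blast
  have c: "e \<in> carrier A" if "e \<in> E" for e using Ec that by blast
  \<comment> \<open>The values of \<open>lam (a _)\<close> on the basis \<open>E\<close> become
    coefficients over \<open>E\<close>. Independence of \<open>E\<close> then says that
    \<open>?T a = 0\<close> only if all these values vanish.\<close>
  let ?T = "\<lambda>a. lincomb (\<lambda>e. lam (a \<otimes>\<^bsub>A\<^esub> e)) E"
  have coef: "(\<lambda>e. lam (a \<otimes>\<^bsub>A\<^esub> e)) \<in> E \<rightarrow> carrier K" if "a \<in> carrier A" for a
    using that c by auto
  have "?T \<in> module_hom K A A"
  proof (rule V.module_homI)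
    show "?T x \<in> carrier A" if "x \<in> carrier A" for x
      using lincomb_closed[OF Ec coef[OF that]] .
    fix x assume x: "x \<in> carrier A"
    show "?T (x \<oplus>\<^bsub>A\<^esub> y) = ?T x \<oplus>\<^bsub>A\<^esub> ?T y" if y: "y \<in> carrier A" for y
    proof -
      have "?T (x \<oplus>\<^bsub>A\<^esub> y) = lincomb (\<lambda>e. lam (x \<otimes>\<^bsub>A\<^esub> e) \<oplus>\<^bsub>K\<^esub> lam (y \<otimes>\<^bsub>A\<^esub> e)) E"
        using c x y by (intro lincomb_cong refl Ec) (auto simp: l_distr lam_add)
      also have "\<dots> = ?T x \<oplus>\<^bsub>A\<^esub> ?T y" by (rule lincomb_sum[OF E(1) Ec coef[OF x] coef[OF y]])
      finally show ?thesis .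
    qed
    show "?T (k \<odot>\<^bsub>A\<^esub> x) = k \<odot>\<^bsub>A\<^esub> ?T x" if k: "k \<in> carrier K" for k
    proof -
      have "?T (k \<odot>\<^bsub>A\<^esub> x) = lincomb (\<lambda>e. k \<otimes>\<^bsub>K\<^esub> lam (x \<otimes>\<^bsub>A\<^esub> e)) E"
        using c x k by (intro lincomb_cong refl Ec) (auto simp: smult_assoc2 lam_smult)
      also have "\<dots> = k \<odot>\<^bsub>A\<^esub> ?T x" by (rule lincomb_smult[OF Ec coef[OF x] k])
      finally show ?thesis .
    qed
  qed
  then interpret T: linear_map K A A ?T by unfold_locales
  have "T.im \<subseteq> D"
  proof
    fix y assume "y \<in> T.im"
    then obtain a where a: "a \<in> carrier A" "y = ?T a" by (auto simp: T.im_def)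
    then have "y \<in> span E" using finite_span[OF E(1) Ec] coef[OF a(1)] by blast
    then show "y \<in> D" using E(4) by simp
  qed
  then have "V.sdim T.im \<le> V.sdim D"
    by (rule V.sdim_mono[OF fin_dim T.imT_is_subspace D])
  moreover have "T.ker \<subseteq> orth D"
  proof
    fix a assume "a \<in> T.ker"
    then have a: "a \<in> carrier A" "?T a = \<zero>\<^bsub>A\<^esub>" by (auto simp: T.ker_def)
    have "lam (a \<otimes>\<^bsub>A\<^esub> e) = \<zero>\<^bsub>K\<^esub>" if "e \<in> E" for e
      using lin_dep_crit[OF E(1) subset_refl coef[OF a(1)] that _ a(2)] E(3) by blast
    then have "E \<subseteq> {x \<in> D. lam (a \<otimes>\<^bsub>A\<^esub> x) = \<zero>\<^bsub>K\<^esub>}" using E(2) by blast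
    then have "D \<subseteq> {x \<in> D. lam (a \<otimes>\<^bsub>A\<^esub> x) = \<zero>\<^bsub>K\<^esub>}"
      unfolding E(4)[symmetric] by (rule V.span_subspace[OF subspace_lam_mult[OF D a(1)], unfolded E(4)[symmetric]])
    then show "a \<in> orth D" using a(1) by (auto simp: orth_def)
  qed
  then have "V.sdim T.ker \<le> V.sdim (orth D)"
    by (rule V.sdim_mono[OF fin_dim T.kerT_is_subspace orth_subspace[OF Dc]])
  moreover have "V.sdim T.im + V.sdim T.ker = V.sdim (carrier A)"
    using T.rank_nullity[OF fin_dim] by simp
  ultimately show ?thesis by linarith
qed

text \<open>Take a complement \<open>D\<close> of \<open>I\<close>. An element orthogonal to both
  \<open>I\<close> and \<open>D\<close> is orthogonal to \<open>A\<close>, hence zero, so the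
  dimensions of \<open>orth I\<close> and \<open>orth D\<close> add up to at most that of
  \<open>A\<close>. The lower bound for \<open>orth D\<close> turns this into the upper bound for
  \<open>orth I\<close>.\<close>

lemma sdim_orth_le:
  assumes I: "subspace K I A"
  shows "V.sdim (orth I) + V.sdim I \<le> V.sdim (carrier A)"
proof -
  have Ic: "I \<subseteq> carrier A" using V.subspaceD(1)[OF I] .
  have z: "subspace K {\<zero>\<^bsub>A\<^esub>} A" by (rule V.subspaceI) auto
  have "I \<inter> {\<zero>\<^bsub>A\<^esub>} = {\<zero>\<^bsub>A\<^esub>}" using V.subspaceD(2)[OF I] by blast
  then obtain D where D: "subspace K D A" "I \<inter> D = {\<zero>\<^bsub>A\<^esub>}" "submodule_sum I D = carrier A"
    by (rule V.complement_exists[OF fin_dim I z]) blast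
  have Dc: "D \<subseteq> carrier A" using V.subspaceD(1)[OF D(1)] .
  note oI = orth_subspace[OF Ic] and oD = orth_subspace[OF Dc]
  have "a = \<zero>\<^bsub>A\<^esub>" if a: "a \<in> orth I" "a \<in> orth D" for a
  proof (rule nondegenerate)
    show ac: "a \<in> carrier A" using a by (simp add: orth_def)
    fix x assume "x \<in> carrier A"
    then obtain y d where yd: "y \<in> I" "d \<in> D" "x = y \<oplus>\<^bsub>A\<^esub> d"
      unfolding D(3)[symmetric] by (rule V.subspace_sumE)
    then have "y \<in> carrier A" "d \<in> carrier A" using Ic Dc by auto
    then show "lam (a \<otimes>\<^bsub>A\<^esub> x) = \<zero>\<^bsub>K\<^esub>" using a yd ac by (simp add: orth_def r_distr lam_add)
  qed
  then have "orth I \<inter> orth D = {\<zero>\<^bsub>A\<^esub>}"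
    using V.subspaceD(2)[OF oI] V.subspaceD(2)[OF oD] by blast
  then have "V.sdim (orth I) + V.sdim (orth D) = V.sdim (submodule_sum (orth I) (orth D))"
    by (rule V.sdim_direct_sum[OF fin_dim oI oD, symmetric])
  also have "\<dots> \<le> V.sdim (carrier A)"
  proof (rule V.sdim_mono[OF fin_dim _ V.subspace_carrier])
    show s: "subspace K (submodule_sum (orth I) (orth D)) A"
      by (rule V.sum_is_subspace[OF oI oD])
    show "submodule_sum (orth I) (orth D) \<subseteq> carrier A" by (rule V.subspaceD(1)[OF s])
  qed
  finally show ?thesis
    using sdim_orth_ge[OF D(1)] V.sdim_direct_sum[OF fin_dim I D(1,2)] D(3) by simp
qed

end

section \<open>Complements spanned by products\<close>

text \<open>A new element \<open>e\<close> contributes at most the products \<open>g x e\<close>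
  with \<open>x\<close> in the enlarged set; their number is the increment of the binomial
  coefficient.\<close>

lemma card_symmetric_products_le:
  assumes "finite E" "\<And>x y. x \<in> E \<Longrightarrow> y \<in> E \<Longrightarrow> g x y = g y x"
  shows "card {g x y |x y. x \<in> E \<and> y \<in> E} \<le> (card E + 1) choose 2"
  using assms
proof (induct E rule: finite_induct)
  case empty
  then show ?case by simp
next
  case (insert e E)
  let ?Q = "{g x y |x y. x \<in> E \<and> y \<in> E}"
  have fin: "finite ?Q"
    by (rule finite_subset[of _ "(\<lambda>(x, y). g x y) ` (E \<times> E)"]) (use insert.hyps(1) in auto)
  have "{g x y |x y. x \<in> insert e E \<and> y \<in> insert e E} \<subseteq> ?Q \<union> (\<lambda>x. g x e) ` insert e E"
  proof
    fix z assume "z \<in> {g x y |x y. x \<in> insert e E \<and> y \<in> insert e E}"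
    then obtain x y where xy: "z = g x y" "x \<in> insert e E" "y \<in> insert e E" by blast
    show "z \<in> ?Q \<union> (\<lambda>x. g x e) ` insert e E"
    proof (cases "y = e")
      case True
      then show ?thesis using xy by blast
    next
      case False
      then show ?thesis using xy insert.prems[of e y] by (cases "x = e") blast+
    qed
  qed
  then have "card {g x y |x y. x \<in> insert e E \<and> y \<in> insert e E} \<le> card (?Q \<union> (\<lambda>x. g x e) ` insert e E)"
    by (rule card_mono[rotated]) (use fin insert.hyps(1) in auto)
  also have "\<dots> \<le> card ?Q + card (insert e E)"
    using card_Un_le[of ?Q "(\<lambda>x. g x e) ` insert e E"] card_image_le[of "insert e E" "\<lambda>x. g x e"] insert.hyps(1)
    by simp
  also have "\<dots> \<le> ((card E + 1) choose 2) + (card E + 1)"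
    using insert.hyps insert.prems by simp
  also have "\<dots> = (card (insert e E) + 1) choose 2"
    using insert.hyps by (simp add: numeral_2_eq_2)
  finally show ?case .
qed

section \<open>Invertibility of 2 and 3\<close>

text \<open>\<open>characteristic\<close> is a least positive exponent; if \<open>1 + 1 = 0\<close>,
  the only smaller candidate is \<open>1\<close>, which a field excludes.\<close>

lemma (in field) two_ne_zero:
  assumes "characteristic R \<noteq> 2"
  shows "\<one> \<oplus> \<one> \<noteq> \<zero>"
proof
  assume two: "\<one> \<oplus> \<one> = \<zero>"
  let ?P = "\<lambda>p::nat. p > 0 \<and> [p] \<cdot> \<one> = \<zero>"
  have "?P 2" using two by (simp add: numeral_2_eq_2 add_pow_def)
  moreover have "2 \<le> p" if "?P p" for p
    using that one_not_zero by (cases "p = 1") (auto simp: add_pow_def)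
  ultimately have "(LEAST p. ?P p) = 2" by (rule Least_equality)
  moreover have "\<exists>p. ?P p" using \<open>?P 2\<close> by (rule exI)
  ultimately show False using assms unfolding characteristic_def by presburger
qed

text \<open>If \<open>3 = 0\<close>, then \<open>2 = 0\<close> would give \<open>1 = 0\<close>, so
  no smaller exponent works and the characteristic would be 3.\<close>

lemma (in field) three_ne_zero:
  assumes "characteristic R \<noteq> 3"
  shows "\<one> \<oplus> \<one> \<oplus> \<one> \<noteq> \<zero>"
proof
  assume three: "\<one> \<oplus> \<one> \<oplus> \<one> = \<zero>"
  let ?P = "\<lambda>p::nat. p > 0 \<and> [p] \<cdot> \<one> = \<zero>"
  have "?P 3" using three by (simp add: numeral_3_eq_3 add_pow_def)
  moreover have "3 \<le> p" if p: "?P p" for p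
  proof (rule ccontr)
    assume "\<not> 3 \<le> p"
    then have "p = 1 \<or> p = 2" using p by auto
    then show False
    proof
      assume "p = 1"
      then show False using p one_not_zero by (simp add: add_pow_def)
    next
      assume "p = 2"
      then have "\<one> \<oplus> \<one> = \<zero>" using p by (simp add: numeral_2_eq_2 add_pow_def)
      then show False using three one_not_zero by simp
    qed
  qed
  ultimately have "(LEAST p. ?P p) = 3" by (rule Least_equality)
  moreover have "\<exists>p. ?P p" using \<open>?P 3\<close> by (rule exI)
  ultimately show False using assms unfolding characteristic_def by presburger
qed

text \<open>Provides the correction factor \<open>-1/(s - 1)\<close>, with \<open>q\<close> equal to
  2 or 3.\<close>

lemma (in field) neg_inverse_exists:
  assumes "q \<in> carrier R" "q \<noteq> \<zero>"
  obtains k where "k \<in> carrier R" "q \<otimes> k = \<ominus> \<one>"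
proof
  show "\<ominus> (inv q) \<in> carrier R" using assms by simp
  show "q \<otimes> (\<ominus> (inv q)) = \<ominus> \<one>" using assms by (simp add: r_minus field_Units)
qed

context finite_local_algebra
begin

lemma add_diff_cancel:
  "x \<in> carrier A \<Longrightarrow> y \<in> carrier A \<Longrightarrow> x \<oplus>\<^bsub>A\<^esub> (y \<ominus>\<^bsub>A\<^esub> x) = y"
  by (simp add: minus_eq a_lcomm[of x y] r_neg)

lemma sdim_zero: "V.sdim {\<zero>\<^bsub>A\<^esub>} = 0"
  using V.sdim_span_le[of "{}"] V.span_empty by simp

lemma zero_subspace: "subspace K {\<zero>\<^bsub>A\<^esub>} A"
  by (rule V.subspaceI) auto

section \<open>Constructing complements of consecutive powers\<close>

text \<open>Inside \<open>m^i\<close>, the kernel of a projection onto \<open>m^(i+1)\<close> is a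
  complement of \<open>m^(i+1)\<close>.\<close>

lemma complement_exists:
  obtains C where "is_complement i C"
proof -
  obtain p where p: "p \<in> module_hom K A A" "\<And>x. x \<in> carrier A \<Longrightarrow> p x \<in> mpow (Suc i)"
    "\<And>x. x \<in> mpow (Suc i) \<Longrightarrow> p x = x"
  proof (rule V.projection_exists[OF fin_dim mpow_subspace zero_subspace])
    show "mpow (Suc i) \<inter> {\<zero>\<^bsub>A\<^esub>} = {\<zero>\<^bsub>A\<^esub>}" using mpow_closed(2)[of "Suc i"] by blast
  qed blast
  have hom: "p (x \<oplus>\<^bsub>A\<^esub> y) = p x \<oplus>\<^bsub>A\<^esub> p y" "c \<in> carrier K \<Longrightarrow> p (c \<odot>\<^bsub>A\<^esub> x) = c \<odot>\<^bsub>A\<^esub> p x"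
    if "x \<in> carrier A" "y \<in> carrier A" for x y c
    using p(1) that by (auto simp: module_hom_def)
  have p_neg: "p (x \<ominus>\<^bsub>A\<^esub> y) = p x \<ominus>\<^bsub>A\<^esub> p y" if x: "x \<in> carrier A" and y: "y \<in> carrier A" for x y
  proof -
    have "p ((\<ominus>\<^bsub>K\<^esub> \<one>\<^bsub>K\<^esub>) \<odot>\<^bsub>A\<^esub> y) = (\<ominus>\<^bsub>K\<^esub> \<one>\<^bsub>K\<^esub>) \<odot>\<^bsub>A\<^esub> p y" by (rule hom(2)[OF y y]) simp
    then have "p (\<ominus>\<^bsub>A\<^esub> y) = \<ominus>\<^bsub>A\<^esub> p y"
      using smult_minus_1[OF y] smult_minus_1[of "p y"] p(2)[OF y] mpow_carrier by simp
    then show ?thesis using hom(1)[OF x, of "\<ominus>\<^bsub>A\<^esub> y"] y by (simp add: minus_eq)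
  qed
  let ?C = "{x \<in> mpow i. p x = \<zero>\<^bsub>A\<^esub>}"
  have p0: "p \<zero>\<^bsub>A\<^esub> = \<zero>\<^bsub>A\<^esub>" using p(3) mpow_closed(2) by blast
  have "is_complement i ?C"
  proof (rule is_complementI)
    show "subspace K ?C A"
      by (rule V.subspaceI) (use mpow_closed(1-4)[where i = i] hom(1) hom(2)[OF _ zero_closed] p0 mpow_carrier in \<open>auto simp: subset_iff\<close>)
    show "\<exists>b\<in>?C. x \<ominus>\<^bsub>A\<^esub> b \<in> mpow (Suc i)" if x: "x \<in> mpow i" for x
    proof
      have c: "x \<in> carrier A" "p x \<in> carrier A" using x p(2) mpow_carrier by blast+
      have "p (x \<ominus>\<^bsub>A\<^esub> p x) = \<zero>\<^bsub>A\<^esub>" using p_neg[OF c] p(3)[OF p(2)[OF c(1)]] c by simp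
      moreover have "x \<ominus>\<^bsub>A\<^esub> p x \<in> mpow i"
        using mpow_closed(6)[OF x] p(2)[OF c(1)] mpow_antimono[of i "Suc i"] by auto
      ultimately show "x \<ominus>\<^bsub>A\<^esub> p x \<in> ?C" by blast
      have "x \<ominus>\<^bsub>A\<^esub> (x \<ominus>\<^bsub>A\<^esub> p x) = p x" using c by (simp add: minus_eq minus_add r_neg2)
      then show "x \<ominus>\<^bsub>A\<^esub> (x \<ominus>\<^bsub>A\<^esub> p x) \<in> mpow (Suc i)" using p(2)[OF c(1)] by simp
    qed
  qed (use p(3) in auto)
  then show thesis by (rule that)
qed

lemma sdim_generating:
  assumes "subspace K C A" "C \<subseteq> mpow i"
    and "\<And>x. x \<in> mpow i \<Longrightarrow> \<exists>b\<in>C. x \<ominus>\<^bsub>A\<^esub> b \<in> mpow (Suc i)"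
  shows "V.sdim C = V.sdim (C \<inter> mpow (Suc i)) + hilbert_function K A m i"
  using V.sdim_subquotient[OF fin_dim mpow_subspace mpow_subspace assms]
  by (simp add: hilbert_function_def graded_piece_def mpow_def)

text \<open>By \<open>sdim_generating\<close>, the dimension of \<open>C\<close> exceeds the Hilbert
  function by that of \<open>C \<inter> mpow (Suc i)\<close>; the upper bound on \<open>C\<close>
  leaves no room for the intersection.\<close>

lemma is_complementI_sdim:
  assumes C: "subspace K C A" "C \<subseteq> mpow i"
    and gen: "\<And>x. x \<in> mpow i \<Longrightarrow> \<exists>b\<in>C. x \<ominus>\<^bsub>A\<^esub> b \<in> mpow (Suc i)"
    and dim: "V.sdim C \<le> hilbert_function K A m i"
  shows "is_complement i C"
proof (rule is_complementI[OF C _ gen])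
  fix x assume x: "x \<in> C" "x \<in> mpow (Suc i)"
  have s: "subspace K (C \<inter> mpow (Suc i)) A" by (rule V.subspace_Int[OF C(1) mpow_subspace])
  have "{\<zero>\<^bsub>A\<^esub>} = C \<inter> mpow (Suc i)"
    by (rule V.subspace_eqI[OF fin_dim zero_subspace s])
      (use sdim_generating[OF C gen] dim V.subspaceD(2)[OF s] in auto)
  then show "x = \<zero>\<^bsub>A\<^esub>" using x by blast
qed

text \<open>Used to pass from products of basis elements to products of arbitrary elements, one
  factor at a time.\<close>

lemma subspace_mult_preimage:
  assumes "subspace K S A" "a \<in> carrier A"
  shows "subspace K {x \<in> carrier A. a \<otimes>\<^bsub>A\<^esub> x \<in> S} A"
proof (rule V.subspaceI)
  note Ss = V.subspaceD[OF assms(1)]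
  show "\<zero>\<^bsub>A\<^esub> \<in> {x \<in> carrier A. a \<otimes>\<^bsub>A\<^esub> x \<in> S}" using assms(2) Ss(2) by simp
  show "x \<oplus>\<^bsub>A\<^esub> y \<in> {x \<in> carrier A. a \<otimes>\<^bsub>A\<^esub> x \<in> S}"
    if "x \<in> {x \<in> carrier A. a \<otimes>\<^bsub>A\<^esub> x \<in> S}" "y \<in> {x \<in> carrier A. a \<otimes>\<^bsub>A\<^esub> x \<in> S}" for x y
    using that assms(2) Ss(3) by (simp add: r_distr)
  show "c \<odot>\<^bsub>A\<^esub> x \<in> {x \<in> carrier A. a \<otimes>\<^bsub>A\<^esub> x \<in> S}"
    if "c \<in> carrier K" "x \<in> {x \<in> carrier A. a \<otimes>\<^bsub>A\<^esub> x \<in> S}" for c x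
  proof -
    have "a \<otimes>\<^bsub>A\<^esub> (c \<odot>\<^bsub>A\<^esub> x) = c \<odot>\<^bsub>A\<^esub> (a \<otimes>\<^bsub>A\<^esub> x)"
      using smult_assoc2[OF that(1) _ assms(2), of x] that assms(2) by (simp add: m_comm)
    then show ?thesis using that Ss(4) by simp
  qed
qed auto

text \<open>The products of a basis of \<open>W\<close> span \<open>m^2\<close> modulo
  \<open>m^3\<close>, and commutativity leaves at most \<open>(n+1 choose 2)\<close> of them. This
  is \<open>H(2)\<close>, so they are independent modulo \<open>m^3\<close>. The last conclusion,
  minimality of \<open>S\<close>, allows linear properties of \<open>S\<close> to be checked on
  products alone.\<close>

lemma products_complement:
  assumes W: "is_complement 1 W"
    and h2: "hilbert_function K A m 2 = (hilbert_function K A m 1 + 1) choose 2"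
  obtains S where "is_complement 2 S" "\<And>x y. x \<in> W \<Longrightarrow> y \<in> W \<Longrightarrow> x \<otimes>\<^bsub>A\<^esub> y \<in> S"
    "\<And>T. subspace K T A \<Longrightarrow> (\<And>x y. x \<in> W \<Longrightarrow> y \<in> W \<Longrightarrow> x \<otimes>\<^bsub>A\<^esub> y \<in> T) \<Longrightarrow> S \<subseteq> T"
proof -
  note Wc = is_complementD[OF W]
  have Wm: "x \<in> mpow 1" "x \<in> carrier A" if "x \<in> W" for x
    using that Wc(2) mpow_carrier by blast+
  obtain E where E: "finite E" "E \<subseteq> W" "lin_indpt E" "span E = W" "card E = V.sdim W"
    using V.subspace_basis[OF fin_dim Wc(1)] by blast
  have card_E: "card E = hilbert_function K A m 1"
    using sdim_generating[OF Wc(1,2,4)] Wc(3) sdim_zero E(5) by simp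
  let ?Q = "{x \<otimes>\<^bsub>A\<^esub> y |x y. x \<in> E \<and> y \<in> E}" and ?S = "span {x \<otimes>\<^bsub>A\<^esub> y |x y. x \<in> E \<and> y \<in> E}"
  have Ec: "x \<in> carrier A" if "x \<in> E" for x using that E(2) Wm(2) by blast
  have Qc: "?Q \<subseteq> carrier A" using Ec by auto
  have fQ: "finite ?Q"
    by (rule finite_subset[of _ "(\<lambda>(x, y). x \<otimes>\<^bsub>A\<^esub> y) ` (E \<times> E)"]) (use E(1) in auto)
  have S: "subspace K ?S A" by (rule V.span_is_subspace[OF Qc])
  have QS: "x \<otimes>\<^bsub>A\<^esub> y \<in> ?S" if "x \<in> E" "y \<in> E" for x y
    using in_own_span[OF Qc] that by blast
  have EW: "e \<otimes>\<^bsub>A\<^esub> y \<in> ?S" if "e \<in> E" "y \<in> W" for e y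
  proof -
    \<comment> \<open>The second factor is extended from \<open>E\<close> to \<open>W\<close> here;
      commutativity then gives the same for the first factor in \<open>WW\<close>.\<close>
    have "span E \<subseteq> {y \<in> carrier A. e \<otimes>\<^bsub>A\<^esub> y \<in> ?S}"
      by (rule V.span_subspace[OF subspace_mult_preimage[OF S Ec[OF that(1)]]]) (use Ec QS that(1) in blast)
    then show ?thesis using E(4) that(2) by blast
  qed
  have WW: "x \<otimes>\<^bsub>A\<^esub> y \<in> ?S" if "x \<in> W" "y \<in> W" for x y
  proof -
    have "e \<otimes>\<^bsub>A\<^esub> y = y \<otimes>\<^bsub>A\<^esub> e" if "e \<in> E" for e
      using m_comm Ec[OF that] Wm(2)[OF \<open>y \<in> W\<close>] by blast
    then have "E \<subseteq> {z \<in> carrier A. y \<otimes>\<^bsub>A\<^esub> z \<in> ?S}" using EW[OF _ that(2)] Ec by auto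
    then have "span E \<subseteq> {z \<in> carrier A. y \<otimes>\<^bsub>A\<^esub> z \<in> ?S}"
      by (rule V.span_subspace[OF subspace_mult_preimage[OF S Wm(2)[OF that(2)]]])
    then have "y \<otimes>\<^bsub>A\<^esub> x \<in> ?S" using E(4) that(1) by blast
    then show ?thesis using m_comm[OF Wm(2)[OF that(1)] Wm(2)[OF that(2)]] by simp
  qed
  have min: "?S \<subseteq> T" if "subspace K T A" "\<And>x y. x \<in> W \<Longrightarrow> y \<in> W \<Longrightarrow> x \<otimes>\<^bsub>A\<^esub> y \<in> T" for T
    by (rule V.span_subspace[OF that(1)]) (use that(2) E(2) in blast)
  have S2: "?S \<subseteq> mpow 2"
  proof (rule min[OF mpow_subspace])
    show "x \<otimes>\<^bsub>A\<^esub> y \<in> mpow 2" if "x \<in> W" "y \<in> W" for x y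
      using mpow_mult_mem[OF Wm(1)[OF that(1)] Wm(1)[OF that(2)]] by (simp add: numeral_2_eq_2)
  qed
  have "is_complement 2 ?S"
  proof (rule is_complementI_sdim[OF S S2])
    have "V.sdim ?S \<le> card ?Q" by (rule V.sdim_span_le[OF fQ Qc])
    also have "\<dots> \<le> (card E + 1) choose 2"
      by (rule card_symmetric_products_le[OF E(1)]) (use m_comm Ec in blast)
    finally show "V.sdim ?S \<le> hilbert_function K A m 2" using card_E h2 by simp
    have "mpow 2 = ideal_prod A (mpow 1) (mpow 1)" using mpow_mult[of 1 1] by (simp add: numeral_2_eq_2)
    also have "\<dots> \<subseteq> submodule_sum ?S (mpow 3)"
    proof (rule ideal_prod_subset[OF V.sum_is_subspace[OF S mpow_subspace]])
      fix x y assume x: "x \<in> mpow 1" and y: "y \<in> mpow 1"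
      obtain v w where v: "v \<in> W" "x \<ominus>\<^bsub>A\<^esub> v \<in> mpow (Suc 1)" and w: "w \<in> W" "y \<ominus>\<^bsub>A\<^esub> w \<in> mpow (Suc 1)"
        using Wc(4)[OF x] Wc(4)[OF y] by blast
      note c = mpow_carrier[OF x] mpow_carrier[OF y] Wm(2)[OF v(1)] Wm(2)[OF w(1)]
      \<comment> \<open>From \<open>x y = v w + v (y - w) + (x - v) y\<close>: replacing both
        factors by their representatives in \<open>W\<close> costs only elements of
        \<open>m^3\<close>.\<close>
      have "v \<otimes>\<^bsub>A\<^esub> (y \<ominus>\<^bsub>A\<^esub> w) \<oplus>\<^bsub>A\<^esub> (x \<ominus>\<^bsub>A\<^esub> v) \<otimes>\<^bsub>A\<^esub> y \<in> mpow 3"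
        using mpow_mult_mem[OF Wm(1)[OF v(1)] w(2)] mpow_mult_mem[OF v(2) y] mpow_closed(3)[of _ 3]
        by (simp add: numeral_3_eq_3)
      then have "v \<otimes>\<^bsub>A\<^esub> w \<oplus>\<^bsub>A\<^esub> (v \<otimes>\<^bsub>A\<^esub> (y \<ominus>\<^bsub>A\<^esub> w) \<oplus>\<^bsub>A\<^esub> (x \<ominus>\<^bsub>A\<^esub> v) \<otimes>\<^bsub>A\<^esub> y) \<in> submodule_sum ?S (mpow 3)"
        by (rule V.subspace_sum_mem[OF WW[OF v(1) w(1)]])
      moreover have "v \<otimes>\<^bsub>A\<^esub> w \<oplus>\<^bsub>A\<^esub> (v \<otimes>\<^bsub>A\<^esub> (y \<ominus>\<^bsub>A\<^esub> w) \<oplus>\<^bsub>A\<^esub> (x \<ominus>\<^bsub>A\<^esub> v) \<otimes>\<^bsub>A\<^esub> y) = x \<otimes>\<^bsub>A\<^esub> y"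
      proof -
        have "v \<otimes>\<^bsub>A\<^esub> w \<oplus>\<^bsub>A\<^esub> v \<otimes>\<^bsub>A\<^esub> (y \<ominus>\<^bsub>A\<^esub> w) = v \<otimes>\<^bsub>A\<^esub> y"
          using r_distr[of w "y \<ominus>\<^bsub>A\<^esub> w" v] add_diff_cancel[of w y] c by simp
        moreover have "v \<otimes>\<^bsub>A\<^esub> y \<oplus>\<^bsub>A\<^esub> (x \<ominus>\<^bsub>A\<^esub> v) \<otimes>\<^bsub>A\<^esub> y = x \<otimes>\<^bsub>A\<^esub> y"
          using l_distr[of v "x \<ominus>\<^bsub>A\<^esub> v" y] add_diff_cancel[of v x] c by simp
        moreover have "v \<otimes>\<^bsub>A\<^esub> w \<oplus>\<^bsub>A\<^esub> (v \<otimes>\<^bsub>A\<^esub> (y \<ominus>\<^bsub>A\<^esub> w) \<oplus>\<^bsub>A\<^esub> (x \<ominus>\<^bsub>A\<^esub> v) \<otimes>\<^bsub>A\<^esub> y) =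
            v \<otimes>\<^bsub>A\<^esub> w \<oplus>\<^bsub>A\<^esub> v \<otimes>\<^bsub>A\<^esub> (y \<ominus>\<^bsub>A\<^esub> w) \<oplus>\<^bsub>A\<^esub> (x \<ominus>\<^bsub>A\<^esub> v) \<otimes>\<^bsub>A\<^esub> y"
          by (rule a_assoc[symmetric]) (use c in simp_all)
        ultimately show ?thesis by (simp only:)
      qed
      ultimately show "x \<otimes>\<^bsub>A\<^esub> y \<in> submodule_sum ?S (mpow 3)" by simp
    qed
    finally have le: "mpow 2 \<subseteq> submodule_sum ?S (mpow 3)" .
    show "\<exists>b\<in>?S. x \<ominus>\<^bsub>A\<^esub> b \<in> mpow (Suc 2)" if "x \<in> mpow 2" for x
    proof -
      have "x \<in> submodule_sum ?S (mpow 3)" using le that by blast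
      then obtain s t where st: "s \<in> ?S" "t \<in> mpow 3" "x = s \<oplus>\<^bsub>A\<^esub> t" by (rule V.subspace_sumE)
      have "s \<in> carrier A" "t \<in> carrier A"
        using subsetD[OF V.subspaceD(1)[OF S] st(1)] mpow_carrier[OF st(2)] .
      then have "x \<ominus>\<^bsub>A\<^esub> s = t" using st(3) a_comm[of s t] by (simp add: minus_eq a_assoc r_neg)
      then have "x \<ominus>\<^bsub>A\<^esub> s \<in> mpow (Suc 2)" using st(2) by (simp add: numeral_3_eq_3 numeral_2_eq_2)
      then show ?thesis using st(1) by (rule bexI)
    qed
  qed
  then show thesis using WW min by (rule that)
qed

end

section \<open>Correcting the tangent space\<close>

context nondegenerate_functional
begin

text \<open>\<open>m^2 m^(s-1) = m^(s+1) = 0\<close> gives one inclusion, and the dimension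
  hypothesis with \<open>sdim_orth_le\<close> forces equality.\<close>

lemma orth_mpow:
  assumes N: "mpow (Suc s) = {\<zero>\<^bsub>A\<^esub>}" and s: "1 \<le> s"
    and dim: "V.sdim (mpow (s - 1)) + V.sdim (mpow 2) = V.sdim (carrier A)"
  shows "orth (mpow (s - 1)) = mpow 2"
proof (rule sym, rule V.subspace_eqI[OF fin_dim mpow_subspace orth_subspace])
  show "mpow (s - 1) \<subseteq> carrier A" by (rule mpow_closed(1))
  show "V.sdim (orth (mpow (s - 1))) \<le> V.sdim (mpow 2)"
    using sdim_orth_le[OF mpow_subspace, of "s - 1"] dim by simp
  show "mpow 2 \<subseteq> orth (mpow (s - 1))"
  proof
    fix a assume a: "a \<in> mpow 2"
    have "a \<otimes>\<^bsub>A\<^esub> x = \<zero>\<^bsub>A\<^esub>" if "x \<in> mpow (s - 1)" for x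
      using mpow_mult_mem[OF a that] N s by simp
    then show "a \<in> orth (mpow (s - 1))" using mpow_carrier[OF a] lam_zero by (simp add: orth_def)
  qed
qed

text \<open>The functional \<open>k lam (u p(_))\<close>, where \<open>p\<close> projects onto
  \<open>C\<close> and kills \<open>J\<close>, is represented by an element \<open>phi u\<close>.
  Vanishing on \<open>J\<close> places \<open>phi u\<close> in \<open>orth J\<close>, hence in
  \<open>I\<close>; uniqueness of the representing element makes \<open>phi\<close> linear.\<close>

lemma correction_exists:
  assumes C: "subspace K C A" and CJ: "C \<inter> J = {\<zero>\<^bsub>A\<^esub>}" and J: "subspace K J A"
    and orth: "orth J \<subseteq> I" and k: "k \<in> carrier K"
  obtains phi where "phi \<in> module_hom K A A" "\<And>u. u \<in> carrier A \<Longrightarrow> phi u \<in> I"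
    "\<And>u x. u \<in> carrier A \<Longrightarrow> x \<in> C \<Longrightarrow> lam (phi u \<otimes>\<^bsub>A\<^esub> x) = k \<otimes>\<^bsub>K\<^esub> lam (u \<otimes>\<^bsub>A\<^esub> x)"
proof -
  obtain p where p: "p \<in> module_hom K A A" "\<And>x. x \<in> carrier A \<Longrightarrow> p x \<in> C"
    "\<And>x. x \<in> C \<Longrightarrow> p x = x" "\<And>x. x \<in> J \<Longrightarrow> p x = \<zero>\<^bsub>A\<^esub>"
    by (rule V.projection_exists[OF fin_dim C J CJ]) blast
  have pc: "p x \<in> carrier A" if "x \<in> carrier A" for x
    using p(2)[OF that] V.subspaceD(1)[OF C] by blast
  have p_add: "p (x \<oplus>\<^bsub>A\<^esub> y) = p x \<oplus>\<^bsub>A\<^esub> p y" if "x \<in> carrier A" "y \<in> carrier A" for x y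
    using p(1) that by (auto simp: module_hom_def)
  have p_smult: "p (c \<odot>\<^bsub>A\<^esub> x) = c \<odot>\<^bsub>A\<^esub> p x" if "c \<in> carrier K" "x \<in> carrier A" for c x
    using p(1) that by (auto simp: module_hom_def)
  have "\<exists>a\<in>carrier A. \<forall>x\<in>carrier A. k \<otimes>\<^bsub>K\<^esub> lam (u \<otimes>\<^bsub>A\<^esub> p x) = lam (a \<otimes>\<^bsub>A\<^esub> x)" if u: "u \<in> carrier A" for u
  proof (rule representable, rule V.module_homI)
    show "k \<otimes>\<^bsub>K\<^esub> lam (u \<otimes>\<^bsub>A\<^esub> p x) \<in> carrier (self_module K)" if "x \<in> carrier A" for x
      using pc[OF that] u k by (simp add: self_module_def)
    show "k \<otimes>\<^bsub>K\<^esub> lam (u \<otimes>\<^bsub>A\<^esub> p (x \<oplus>\<^bsub>A\<^esub> y)) =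
        k \<otimes>\<^bsub>K\<^esub> lam (u \<otimes>\<^bsub>A\<^esub> p x) \<oplus>\<^bsub>self_module K\<^esub> k \<otimes>\<^bsub>K\<^esub> lam (u \<otimes>\<^bsub>A\<^esub> p y)"
      if "x \<in> carrier A" "y \<in> carrier A" for x y
      using pc that u k by (simp add: self_module_def p_add r_distr lam_add K.r_distr)
    show "k \<otimes>\<^bsub>K\<^esub> lam (u \<otimes>\<^bsub>A\<^esub> p (c \<odot>\<^bsub>A\<^esub> x)) = c \<odot>\<^bsub>self_module K\<^esub> (k \<otimes>\<^bsub>K\<^esub> lam (u \<otimes>\<^bsub>A\<^esub> p x))"
      if "c \<in> carrier K" "x \<in> carrier A" for c x
      using pc that u k by (simp add: self_module_def p_smult mult_smult lam_smult K.m_lcomm)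
  qed
  then obtain phi where phi: "\<And>u. u \<in> carrier A \<Longrightarrow> phi u \<in> carrier A"
    "\<And>u x. u \<in> carrier A \<Longrightarrow> x \<in> carrier A \<Longrightarrow> k \<otimes>\<^bsub>K\<^esub> lam (u \<otimes>\<^bsub>A\<^esub> p x) = lam (phi u \<otimes>\<^bsub>A\<^esub> x)"
    by metis
  \<comment> \<open>Elements are compared through the functionals they represent; this turns
    linearity of the functionals in \<open>u\<close> into linearity of \<open>phi\<close>.\<close>
  have uniq: "a = b" if a: "a \<in> carrier A" and b: "b \<in> carrier A"
    and eq: "\<And>x. x \<in> carrier A \<Longrightarrow> lam (a \<otimes>\<^bsub>A\<^esub> x) = lam (b \<otimes>\<^bsub>A\<^esub> x)" for a b
  proof -
    have "lam ((a \<ominus>\<^bsub>A\<^esub> b) \<otimes>\<^bsub>A\<^esub> x) = \<zero>\<^bsub>K\<^esub>" if "x \<in> carrier A" for x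
      using a b that eq[OF that] by (simp add: minus_eq l_distr l_minus lam_add lam_minus K.r_neg)
    then have "a \<ominus>\<^bsub>A\<^esub> b = \<zero>\<^bsub>A\<^esub>" using a b by (intro nondegenerate) simp_all
    then show ?thesis using a b by simp
  qed
  show thesis
  proof (rule that)
    show "phi \<in> module_hom K A A"
    proof (rule V.module_homI)
      show "phi u \<in> carrier A" if "u \<in> carrier A" for u using phi(1)[OF that] .
      show "phi (u \<oplus>\<^bsub>A\<^esub> v) = phi u \<oplus>\<^bsub>A\<^esub> phi v" if "u \<in> carrier A" "v \<in> carrier A" for u v
        using phi(1) that pc k
        by (intro uniq) (simp_all add: l_distr lam_add K.r_distr phi(2)[symmetric])
      show "phi (c \<odot>\<^bsub>A\<^esub> u) = c \<odot>\<^bsub>A\<^esub> phi u" if "c \<in> carrier K" "u \<in> carrier A" for c u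
        using phi(1) that pc k
        by (intro uniq) (simp_all add: smult_assoc2 lam_smult K.m_lcomm phi(2)[symmetric])
    qed
    show "phi u \<in> I" if u: "u \<in> carrier A" for u
    proof -
      have "lam (phi u \<otimes>\<^bsub>A\<^esub> x) = \<zero>\<^bsub>K\<^esub>" if x: "x \<in> J" for x
      proof -
        have "x \<in> carrier A" using x V.subspaceD(1)[OF J] by blast
        then show ?thesis using phi(2)[OF u, of x] p(4)[OF x] u k lam_zero by simp
      qed
      then show ?thesis using orth phi(1)[OF u] by (auto simp: orth_def)
    qed
    show "lam (phi u \<otimes>\<^bsub>A\<^esub> x) = k \<otimes>\<^bsub>K\<^esub> lam (u \<otimes>\<^bsub>A\<^esub> x)" if "u \<in> carrier A" "x \<in> C" for u x
      using phi(2)[OF that(1), of x] p(3)[OF that(2)] V.subspaceD(1)[OF C] that by auto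
  qed
qed

text \<open>The shift lies in \<open>m^(i+1)\<close> and so leaves all classes modulo
  \<open>m^(i+1)\<close> unchanged; linearity of \<open>phi\<close> keeps the image a
  subspace.\<close>

lemma shifted_complement:
  assumes W: "is_complement i W" and hom: "phi \<in> module_hom K A A"
    and phi: "\<And>u. u \<in> carrier A \<Longrightarrow> phi u \<in> mpow (Suc i)"
  shows "is_complement i ((\<lambda>u. u \<oplus>\<^bsub>A\<^esub> phi u) ` W)"
proof -
  note Wc = is_complementD[OF W] and Ws = V.subspaceD[OF is_complementD(1)[OF W]]
  have c: "u \<in> carrier A" "u \<in> mpow i" "phi u \<in> carrier A" if "u \<in> W" for u
    using that Ws(1) Wc(2) phi mpow_carrier by blast+
  have add: "phi (u \<oplus>\<^bsub>A\<^esub> v) = phi u \<oplus>\<^bsub>A\<^esub> phi v" if "u \<in> carrier A" "v \<in> carrier A" for u v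
    using hom that by (auto simp: module_hom_def)
  have sm: "phi (k \<odot>\<^bsub>A\<^esub> u) = k \<odot>\<^bsub>A\<^esub> phi u" if "k \<in> carrier K" "u \<in> carrier A" for k u
    using hom that by (auto simp: module_hom_def)
  have phi0: "phi \<zero>\<^bsub>A\<^esub> = \<zero>\<^bsub>A\<^esub>"
    using sm[of "\<zero>\<^bsub>K\<^esub>" "\<zero>\<^bsub>A\<^esub>"] phi[of "\<zero>\<^bsub>A\<^esub>"] mpow_carrier by simp
  let ?h = "\<lambda>u. u \<oplus>\<^bsub>A\<^esub> phi u"
  show ?thesis
  proof (rule is_complementI)
    show "subspace K (?h ` W) A"
    proof (rule V.subspaceI)
      show "?h ` W \<subseteq> carrier A" using c by auto
      show "\<zero>\<^bsub>A\<^esub> \<in> ?h ` W" using Ws(2) phi0 by (intro image_eqI[of _ _ "\<zero>\<^bsub>A\<^esub>"]) simp_all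
      show "x \<oplus>\<^bsub>A\<^esub> y \<in> ?h ` W" if xy: "x \<in> ?h ` W" "y \<in> ?h ` W" for x y
      proof -
        obtain u v where "u \<in> W" "v \<in> W" "x = ?h u" "y = ?h v" using xy by blast
        then show ?thesis using c Ws(3) by (intro image_eqI[of _ _ "u \<oplus>\<^bsub>A\<^esub> v"]) (simp_all add: add a_ac)
      qed
      show "k \<odot>\<^bsub>A\<^esub> x \<in> ?h ` W" if kx: "k \<in> carrier K" "x \<in> ?h ` W" for k x
      proof -
        obtain u where "u \<in> W" "x = ?h u" using kx(2) by blast
        then show ?thesis using c Ws(4) kx(1)
          by (intro image_eqI[of _ _ "k \<odot>\<^bsub>A\<^esub> u"]) (simp_all add: sm smult_r_distr)
      qed
    qed
    show "?h ` W \<subseteq> mpow i"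
    proof (rule image_subsetI)
      fix u assume u: "u \<in> W"
      have "phi u \<in> mpow i" using phi[OF c(1)[OF u]] mpow_antimono[of i "Suc i"] by auto
      then show "?h u \<in> mpow i" by (rule mpow_closed(3)[OF c(2)[OF u]])
    qed
    show "x = \<zero>\<^bsub>A\<^esub>" if x: "x \<in> ?h ` W" "x \<in> mpow (Suc i)" for x
    proof -
      obtain u where u: "u \<in> W" "x = ?h u" using x by blast
      have "?h u \<ominus>\<^bsub>A\<^esub> phi u \<in> mpow (Suc i)"
        using mpow_closed(6)[OF _ phi[OF c(1)[OF u(1)]], of x] x(2) u(2) by simp
      moreover have "?h u \<ominus>\<^bsub>A\<^esub> phi u = u" using c[OF u(1)] by (simp add: minus_eq a_assoc r_neg)
      ultimately have "u = \<zero>\<^bsub>A\<^esub>" using u(1) Wc(3) by auto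
      then show ?thesis using u(2) phi0 by simp
    qed
    show "\<exists>b\<in>?h ` W. x \<ominus>\<^bsub>A\<^esub> b \<in> mpow (Suc i)" if x: "x \<in> mpow i" for x
    proof -
      obtain u where u: "u \<in> W" "x \<ominus>\<^bsub>A\<^esub> u \<in> mpow (Suc i)" using Wc(4)[OF x] by blast
      have "x \<ominus>\<^bsub>A\<^esub> u \<ominus>\<^bsub>A\<^esub> phi u \<in> mpow (Suc i)"
        using mpow_closed(6)[OF u(2) phi[OF c(1)[OF u(1)]]] .
      moreover have "x \<ominus>\<^bsub>A\<^esub> u \<ominus>\<^bsub>A\<^esub> phi u = x \<ominus>\<^bsub>A\<^esub> ?h u"
        using c[OF u(1)] mpow_carrier[OF x] by (simp add: minus_eq a_assoc minus_add)
      ultimately show ?thesis using u(1) by auto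
    qed
  qed
qed

text \<open>In degrees \<open>s - 1\<close> and \<open>s\<close> the pieces are forced: \<open>m^(s-1) \<inter> ker lam\<close> and \<open>m^s\<close>.\<close>

lemma algebra_iso_of_pieces:
  assumes N: "mpow (Suc s) = {\<zero>\<^bsub>A\<^esub>}" and top: "mpow s \<noteq> {\<zero>\<^bsub>A\<^esub>}" and s: "2 \<le> s"
    and C: "\<And>i. 0 < i \<Longrightarrow> i < s - 1 \<Longrightarrow> is_complement i (C i)"
    and C_mult: "\<And>i j x y. 0 < i \<Longrightarrow> 0 < j \<Longrightarrow> i + j < s - 1 \<Longrightarrow> x \<in> C i \<Longrightarrow> y \<in> C j \<Longrightarrow> x \<otimes>\<^bsub>A\<^esub> y \<in> C (i + j)"
    and C_lam: "\<And>i j x y. 0 < i \<Longrightarrow> 0 < j \<Longrightarrow> i + j = s - 1 \<Longrightarrow> x \<in> C i \<Longrightarrow> y \<in> C j \<Longrightarrow> lam (x \<otimes>\<^bsub>A\<^esub> y) = \<zero>\<^bsub>K\<^esub>"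
  shows "algebra_iso K A (associated_graded A m) \<noteq> {}"
proof -
  let ?L = "{x \<in> mpow (s - 1). lam x = \<zero>\<^bsub>K\<^esub>}"
  let ?B = "\<lambda>i. if i = 0 then {c \<odot>\<^bsub>A\<^esub> \<one>\<^bsub>A\<^esub> |c. c \<in> carrier K} else if i < s - 1 then C i
    else if i = s - 1 then ?L else mpow i"
  have above: "mpow i = {\<zero>\<^bsub>A\<^esub>}" if "s < i" for i
    using mpow_antimono[of "Suc s" i] that N mpow_closed(2)[of i] by auto
  \<comment> \<open>Since \<open>m\<close> annihilates \<open>m^s\<close>, an element
    \<open>x\<close> of \<open>m^s\<close> satisfies \<open>a x = c x\<close>, where
    \<open>c\<close> is the residue of \<open>a\<close>. If \<open>lam x = 0\<close>, then
    \<open>lam\<close> vanishes on all multiples of \<open>x\<close>, and nondegeneracy gives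
    \<open>x = 0\<close>.\<close>
  have socle: "x = \<zero>\<^bsub>A\<^esub>" if x: "x \<in> mpow s" "lam x = \<zero>\<^bsub>K\<^esub>" for x
  proof (rule nondegenerate)
    show xc: "x \<in> carrier A" by (rule mpow_carrier[OF x(1)])
    fix a assume "a \<in> carrier A"
    then obtain c y where cy: "c \<in> carrier K" "y \<in> m" "a = c \<odot>\<^bsub>A\<^esub> \<one>\<^bsub>A\<^esub> \<oplus>\<^bsub>A\<^esub> y"
      by (rule scalar_decomposition)
    have yc: "y \<in> carrier A" by (rule ideal.Icarr[OF m_ideal cy(2)])
    have "x \<otimes>\<^bsub>A\<^esub> y = \<zero>\<^bsub>A\<^esub>" using mpow_mult_mem[OF x(1), of y 1] cy(2) mpow_1 N by simp
    then have "x \<otimes>\<^bsub>A\<^esub> a = c \<odot>\<^bsub>A\<^esub> x" using cy xc yc by (simp add: r_distr mult_smult)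
    then show "lam (x \<otimes>\<^bsub>A\<^esub> a) = \<zero>\<^bsub>K\<^esub>" using lam_smult[OF cy(1) xc] x(2) cy(1) by simp
  qed
  have "is_complement i (?B i)" for i
  proof -
    consider "i = 0" | "0 < i" "i < s - 1" | "i = s - 1" | "s \<le> i" by linarith
    then show ?thesis
    proof cases
      case 1
      have "is_complement 0 {c \<odot>\<^bsub>A\<^esub> \<one>\<^bsub>A\<^esub> |c. c \<in> carrier K}" (is "is_complement 0 ?S")
      proof (rule is_complementI)
        show "subspace K ?S A"
        proof (rule V.subspaceI)
          show "?S \<subseteq> carrier A" by auto
          show "\<zero>\<^bsub>A\<^esub> \<in> ?S" by (rule CollectI, rule exI[of _ "\<zero>\<^bsub>K\<^esub>"]) simp
          show "x \<oplus>\<^bsub>A\<^esub> y \<in> ?S" if xy: "x \<in> ?S" "y \<in> ?S" for x y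
          proof -
            obtain c d where "c \<in> carrier K" "d \<in> carrier K" "x = c \<odot>\<^bsub>A\<^esub> \<one>\<^bsub>A\<^esub>" "y = d \<odot>\<^bsub>A\<^esub> \<one>\<^bsub>A\<^esub>"
              using xy by blast
            then show ?thesis by (intro CollectI exI[of _ "c \<oplus>\<^bsub>K\<^esub> d"]) (simp add: smult_l_distr)
          qed
          show "k \<odot>\<^bsub>A\<^esub> x \<in> ?S" if kx: "k \<in> carrier K" "x \<in> ?S" for k x
          proof -
            obtain c where "c \<in> carrier K" "x = c \<odot>\<^bsub>A\<^esub> \<one>\<^bsub>A\<^esub>" using kx by blast
            then show ?thesis using kx(1) by (intro CollectI exI[of _ "k \<otimes>\<^bsub>K\<^esub> c"]) (simp add: smult_assoc1)
          qed
        qed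
        show "?S \<subseteq> mpow 0" by auto
        show "x = \<zero>\<^bsub>A\<^esub>" if x: "x \<in> ?S" "x \<in> mpow (Suc 0)" for x
        proof -
          obtain c where c: "c \<in> carrier K" "x = c \<odot>\<^bsub>A\<^esub> \<one>\<^bsub>A\<^esub>" using x(1) by blast
          then have "c = \<zero>\<^bsub>K\<^esub>" using scalar_in_m[OF c(1)] x(2) mpow_1 by simp
          then show ?thesis using c(2) by simp
        qed
        show "\<exists>b\<in>?S. x \<ominus>\<^bsub>A\<^esub> b \<in> mpow (Suc 0)" if "x \<in> mpow 0" for x
        proof -
          have xc: "x \<in> carrier A" using that by simp
          then obtain c y where cy: "c \<in> carrier K" "y \<in> m" "x = c \<odot>\<^bsub>A\<^esub> \<one>\<^bsub>A\<^esub> \<oplus>\<^bsub>A\<^esub> y"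
            by (rule scalar_decomposition)
          have yc: "y \<in> carrier A" by (rule ideal.Icarr[OF m_ideal cy(2)])
          have "x \<ominus>\<^bsub>A\<^esub> c \<odot>\<^bsub>A\<^esub> \<one>\<^bsub>A\<^esub> = y"
            using cy yc a_comm[of "c \<odot>\<^bsub>A\<^esub> \<one>\<^bsub>A\<^esub>" y] by (simp add: minus_eq a_assoc r_neg)
          then show ?thesis using cy mpow_1 by auto
        qed
      qed
      then show ?thesis using 1 by simp
    next
      case 2
      then show ?thesis using C by simp
    next
      case 3
      have "is_complement (s - 1) ?L"
      proof (rule is_complementI)
        have "subspace K {x \<in> mpow (s - 1). lam (\<one>\<^bsub>A\<^esub> \<otimes>\<^bsub>A\<^esub> x) = \<zero>\<^bsub>K\<^esub>} A"
          by (rule subspace_lam_mult[OF mpow_subspace one_closed])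
        moreover have "{x \<in> mpow (s - 1). lam (\<one>\<^bsub>A\<^esub> \<otimes>\<^bsub>A\<^esub> x) = \<zero>\<^bsub>K\<^esub>} = ?L" using mpow_carrier by auto
        ultimately show "subspace K ?L A" by simp
        have ss: "Suc (s - 1) = s" using s by simp
        show "x = \<zero>\<^bsub>A\<^esub>" if "x \<in> ?L" "x \<in> mpow (Suc (s - 1))" for x
          using socle[of x] that ss by simp
        show "\<exists>b\<in>?L. x \<ominus>\<^bsub>A\<^esub> b \<in> mpow (Suc (s - 1))" if x: "x \<in> mpow (s - 1)" for x
        proof -
          have xc: "x \<in> carrier A" by (rule mpow_carrier[OF x])
          obtain w where w: "w \<in> mpow s" "w \<noteq> \<zero>\<^bsub>A\<^esub>" using top mpow_closed(2)[of s] by auto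
          have wc: "w \<in> carrier A" by (rule mpow_carrier[OF w(1)])
          have lw: "lam w \<noteq> \<zero>\<^bsub>K\<^esub>" using socle[OF w(1)] w(2) by blast
          \<comment> \<open>\<open>lam w\<close> is nonzero, so subtracting the multiple of
            \<open>w\<close> with ratio \<open>lam x / lam w\<close> moves \<open>x\<close> into the
            kernel of \<open>lam\<close> by an element of \<open>m^s\<close>.\<close>
          let ?k = "lam x \<otimes>\<^bsub>K\<^esub> inv\<^bsub>K\<^esub> (lam w)"
          have inv: "inv\<^bsub>K\<^esub> (lam w) \<in> carrier K" "inv\<^bsub>K\<^esub> (lam w) \<otimes>\<^bsub>K\<^esub> lam w = \<one>\<^bsub>K\<^esub>"
            using lw wc by (auto simp: K.field_Units)
          have kc: "?k \<in> carrier K" using xc inv(1) by simp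
          have z: "?k \<odot>\<^bsub>A\<^esub> w \<in> mpow s" by (rule mpow_closed(4)[OF kc w(1)])
          have "?k \<otimes>\<^bsub>K\<^esub> lam w = lam x" using inv xc wc by (simp add: K.m_assoc)
          then have "lam (x \<ominus>\<^bsub>A\<^esub> ?k \<odot>\<^bsub>A\<^esub> w) = \<zero>\<^bsub>K\<^esub>"
            using xc wc kc by (simp add: minus_eq lam_add lam_minus lam_smult K.r_neg)
          moreover have "x \<ominus>\<^bsub>A\<^esub> ?k \<odot>\<^bsub>A\<^esub> w \<in> mpow (s - 1)"
            using mpow_closed(6)[OF x] z mpow_antimono[of "s - 1" s] by auto
          moreover have "x \<ominus>\<^bsub>A\<^esub> (x \<ominus>\<^bsub>A\<^esub> ?k \<odot>\<^bsub>A\<^esub> w) = ?k \<odot>\<^bsub>A\<^esub> w"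
            using xc wc kc by (simp add: minus_eq minus_add r_neg2)
          ultimately show ?thesis using z ss by (intro bexI[of _ "x \<ominus>\<^bsub>A\<^esub> ?k \<odot>\<^bsub>A\<^esub> w"]) simp_all
        qed
      qed blast
      \<comment> \<open>\<open>2 \<le> s\<close> makes \<open>s - 1\<close> positive, so this degree
        is not the one holding the scalars.\<close>
      then show ?thesis using 3 s by simp
    next
      case 4
      have "is_complement i (mpow i)"
      proof (rule is_complementI[OF mpow_subspace subset_refl])
        show "x = \<zero>\<^bsub>A\<^esub>" if "x \<in> mpow (Suc i)" for x using that above[of "Suc i"] 4 by simp
        show "\<exists>b\<in>mpow i. x \<ominus>\<^bsub>A\<^esub> b \<in> mpow (Suc i)" if "x \<in> mpow i" for x
          using that mpow_carrier[OF that] mpow_closed(2)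
          by (intro bexI[of _ x]) (simp_all add: minus_eq r_neg)
      qed
      moreover have "i \<noteq> 0" "\<not> i < s - 1" "i \<noteq> s - 1" using 4 s by linarith+
      ultimately show ?thesis by (simp only: if_False)
    qed
  qed
  note B = this
  have "graded_splitting K A m ?B s"
  proof unfold_locales
    show "mpow (Suc s) = {\<zero>\<^bsub>A\<^esub>}" by (rule N)
    show "is_complement i (?B i)" for i by (rule B)
    show "\<one>\<^bsub>A\<^esub> \<in> ?B 0" by (simp, rule exI[of _ "\<one>\<^bsub>K\<^esub>"]) simp
    show "x \<otimes>\<^bsub>A\<^esub> y \<in> ?B (i + j)" if x: "x \<in> ?B i" and y: "y \<in> ?B j" for i j x y
    proof -
      have xm: "x \<in> mpow i" "x \<in> carrier A" and ym: "y \<in> mpow j" "y \<in> carrier A"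
        using x y is_complementD(2)[OF B, of i] is_complementD(2)[OF B, of j] mpow_carrier by blast+
      note xy = mpow_mult_mem[OF xm(1) ym(1)]
      note Bs = V.subspaceD(4)[OF is_complementD(1)[OF B]]
      \<comment> \<open>A factor of degree 0 is a scalar and preserves every piece. Among positive
        degrees, only total degree \<open>s - 1\<close> brings in \<open>lam\<close>; from
        \<open>s\<close> on, the piece is the whole power.\<close>
      consider "i = 0" | "j = 0" | "0 < i" "0 < j" "i + j < s - 1" | "0 < i" "0 < j" "i + j = s - 1"
        | "s \<le> i + j" "0 < i" "0 < j" by linarith
      then show ?thesis
      proof cases
        case 1
        then obtain c where c: "c \<in> carrier K" "x = c \<odot>\<^bsub>A\<^esub> \<one>\<^bsub>A\<^esub>" using x by auto
        then have "x \<otimes>\<^bsub>A\<^esub> y = c \<odot>\<^bsub>A\<^esub> y" using ym by (simp add: smult_assoc2)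
        then show ?thesis using Bs[OF c(1) y] 1 by (simp only: add_0_left)
      next
        case 2
        then obtain c where c: "c \<in> carrier K" "y = c \<odot>\<^bsub>A\<^esub> \<one>\<^bsub>A\<^esub>" using y by auto
        then have "x \<otimes>\<^bsub>A\<^esub> y = c \<odot>\<^bsub>A\<^esub> x" using xm by (simp add: mult_smult)
        then show ?thesis using Bs[OF c(1) x] 2 by (simp only: add_0_right)
      next
        case 3
        then show ?thesis using C_mult[of i j x y] x y by simp
      next
        case 4
        then show ?thesis using C_lam[of i j x y] x y xy s by simp
      next
        case 5
        then have "i + j \<noteq> 0" "\<not> i + j < s - 1" "i + j \<noteq> s - 1" using s by linarith+
        then show ?thesis using xy by (simp only: if_False)
      qed
    qed
  qed
  then show ?thesis by (rule graded_splitting.algebra_iso_associated_graded)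
qed

section \<open>The two Hilbert functions\<close>

lemma mpow_dims:
  assumes "hilbert_function K A m (Suc s) = 0"
  shows "mpow (Suc s) = {\<zero>\<^bsub>A\<^esub>}"
    and "V.sdim (mpow s) = hilbert_function K A m s"
    and "hilbert_function K A m s \<noteq> 0 \<Longrightarrow> mpow s \<noteq> {\<zero>\<^bsub>A\<^esub>}"
proof -
  show 0: "mpow (Suc s) = {\<zero>\<^bsub>A\<^esub>}" by (rule mpow_eq_zero[OF assms])
  then show "V.sdim (mpow s) = hilbert_function K A m s" using sdim_mpow[of s] sdim_zero by simp
  then show "mpow s \<noteq> {\<zero>\<^bsub>A\<^esub>}" if "hilbert_function K A m s \<noteq> 0" using that sdim_zero by auto
qed

text \<open>Here \<open>m^2\<close> has dimension \<open>n + 1\<close>, half of that of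
  \<open>A\<close>, and is its own orthogonal space. The corrected product of \<open>u\<close> and
  \<open>v\<close> has value \<open>(1 + 2 k) lam (u v)\<close>, and
  \<open>2 k = -1\<close>.\<close>

lemma algebra_iso_socle_degree_3:
  assumes char: "characteristic K \<noteq> 2" and H: "has_hilbert_vector K A m [1, n, n, 1]"
  shows "algebra_iso K A (associated_graded A m) \<noteq> {}"
proof -
  have h: "hilbert_function K A m i = (if i < length [1, n, n, 1] then [1, n, n, 1] ! i else 0)" for i
    using H unfolding has_hilbert_vector_def by blast
  have hs: "hilbert_function K A m 0 = 1" "hilbert_function K A m 1 = n" "hilbert_function K A m 2 = n"
    "hilbert_function K A m 3 = 1" "hilbert_function K A m (Suc 3) = 0"
    by (simp_all add: h)
  note top = mpow_dims[OF hs(5)]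
  have "V.sdim (mpow 3) = 1" using top(2) hs(4) by simp
  then have d2: "V.sdim (mpow 2) = n + 1" using sdim_mpow[of 2] hs(3) by (simp add: numeral_3_eq_3 numeral_2_eq_2)
  then have "V.sdim (mpow 1) = n + (n + 1)" using sdim_mpow[of 1] hs(2) by (simp add: numeral_2_eq_2)
  then have d0: "V.sdim (carrier A) = (n + 1) + (n + 1)" using sdim_mpow[of 0] hs(1) by simp
  have orth: "orth (mpow 2) = mpow 2"
    using orth_mpow[OF top(1)] d2 d0 by simp
  obtain W where W: "is_complement 1 W" by (rule complement_exists)
  note Wc = is_complementD[OF W]
  have q: "\<one>\<^bsub>K\<^esub> \<oplus>\<^bsub>K\<^esub> \<one>\<^bsub>K\<^esub> \<in> carrier K" by simp
  obtain k where k: "k \<in> carrier K" "(\<one>\<^bsub>K\<^esub> \<oplus>\<^bsub>K\<^esub> \<one>\<^bsub>K\<^esub>) \<otimes>\<^bsub>K\<^esub> k = \<ominus>\<^bsub>K\<^esub> \<one>\<^bsub>K\<^esub>"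
    by (rule K.neg_inverse_exists[OF q K.two_ne_zero[OF char]])
  have W2: "W \<inter> mpow 2 = {\<zero>\<^bsub>A\<^esub>}" using Wc(3) by (simp add: numeral_2_eq_2)
  obtain phi where phi: "phi \<in> module_hom K A A" "\<And>u. u \<in> carrier A \<Longrightarrow> phi u \<in> mpow 2"
    "\<And>u x. u \<in> carrier A \<Longrightarrow> x \<in> W \<Longrightarrow> lam (phi u \<otimes>\<^bsub>A\<^esub> x) = k \<otimes>\<^bsub>K\<^esub> lam (u \<otimes>\<^bsub>A\<^esub> x)"
    by (rule correction_exists[OF Wc(1) W2 mpow_subspace _ k(1), of "mpow 2"]) (use orth in blast)+
  let ?W = "(\<lambda>u. u \<oplus>\<^bsub>A\<^esub> phi u) ` W"
  have W': "is_complement 1 ?W"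
    by (rule shifted_complement[OF W phi(1)]) (use phi(2) in \<open>simp add: numeral_2_eq_2\<close>)
  have lam: "lam ((u \<oplus>\<^bsub>A\<^esub> phi u) \<otimes>\<^bsub>A\<^esub> (v \<oplus>\<^bsub>A\<^esub> phi v)) = \<zero>\<^bsub>K\<^esub>" if u: "u \<in> W" and v: "v \<in> W" for u v
  proof -
    have c: "u \<in> carrier A" "v \<in> carrier A" using u v V.subspaceD(1)[OF Wc(1)] by blast+
    have pc: "phi u \<in> carrier A" "phi v \<in> carrier A" using phi(2) c mpow_carrier by blast+
    \<comment> \<open>Both corrections lie in \<open>m^2\<close>, so their product is in
      \<open>m^4 = 0\<close> and no quadratic term in \<open>k\<close> appears.\<close>
    have pp: "phi u \<otimes>\<^bsub>A\<^esub> phi v = \<zero>\<^bsub>A\<^esub>"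
      using mpow_mult_mem[OF phi(2)[OF c(1)] phi(2)[OF c(2)]] top(1) by simp
    let ?l = "lam (u \<otimes>\<^bsub>A\<^esub> v)"
    have l: "?l \<in> carrier K" using c by simp
    have 1: "lam (phi u \<otimes>\<^bsub>A\<^esub> v) = k \<otimes>\<^bsub>K\<^esub> ?l" by (rule phi(3)[OF c(1) v])
    have 2: "lam (u \<otimes>\<^bsub>A\<^esub> phi v) = k \<otimes>\<^bsub>K\<^esub> ?l"
      using phi(3)[OF c(2) u] c pc by (simp add: m_comm)
    have "lam ((u \<oplus>\<^bsub>A\<^esub> phi u) \<otimes>\<^bsub>A\<^esub> (v \<oplus>\<^bsub>A\<^esub> phi v)) =
        ?l \<oplus>\<^bsub>K\<^esub> (k \<otimes>\<^bsub>K\<^esub> ?l \<oplus>\<^bsub>K\<^esub> k \<otimes>\<^bsub>K\<^esub> ?l)"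
      using c pc k(1) by (simp add: l_distr r_distr lam_add 1 2 pp K.a_ac)
    also have "\<dots> = ?l \<oplus>\<^bsub>K\<^esub> ((\<one>\<^bsub>K\<^esub> \<oplus>\<^bsub>K\<^esub> \<one>\<^bsub>K\<^esub>) \<otimes>\<^bsub>K\<^esub> k) \<otimes>\<^bsub>K\<^esub> ?l"
      using l k(1) by (simp add: K.l_distr)
    also have "\<dots> = \<zero>\<^bsub>K\<^esub>" unfolding k(2) using l by (simp add: K.l_minus K.r_neg)
    finally show ?thesis .
  qed
  show ?thesis
  \<comment> \<open>Only degree 1 lies strictly between 0 and \<open>s - 1 = 2\<close>, so a
    constant family serves; closure under products below degree 2 is vacuous.\<close>
  proof (rule algebra_iso_of_pieces[where s = 3 and C = "\<lambda>_. ?W"])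
    show "mpow (Suc 3) = {\<zero>\<^bsub>A\<^esub>}" by (rule top(1))
    show "mpow 3 \<noteq> {\<zero>\<^bsub>A\<^esub>}" using top(3) hs(4) by simp
    show "is_complement i ?W" if "0 < i" "i < 3 - 1" for i
      using W' that by (cases "i = 1") simp_all
    show "lam (x \<otimes>\<^bsub>A\<^esub> y) = \<zero>\<^bsub>K\<^esub>" if "x \<in> ?W" "y \<in> ?W" for x y
      using that lam by blast
  qed simp_all
qed

text \<open>The dimension of \<open>m^3\<close> is \<open>n + 1\<close>, which is also the
  codimension of \<open>m^2\<close>, so \<open>m^2\<close> is the orthogonal space of
  \<open>m^3\<close>. The value of \<open>H(2)\<close> makes products of degree 1 elements a
  complement in degree 2, before and after the correction.\<close>

lemma algebra_iso_socle_degree_4: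
  assumes char: "characteristic K \<noteq> 3" and H: "has_hilbert_vector K A m [1, n, (n + 1) choose 2, n, 1]"
  shows "algebra_iso K A (associated_graded A m) \<noteq> {}"
proof -
  let ?v = "[1, n, (n + 1) choose 2, n, 1]"
  have h: "hilbert_function K A m i = (if i < length ?v then ?v ! i else 0)" for i
    using H unfolding has_hilbert_vector_def by blast
  have hs: "hilbert_function K A m 0 = 1" "hilbert_function K A m 1 = n"
    "hilbert_function K A m 2 = (n + 1) choose 2" "hilbert_function K A m 3 = n"
    "hilbert_function K A m 4 = 1" "hilbert_function K A m (Suc 4) = 0"
    by (simp_all add: h)
  have suc: "Suc 3 = 4" "Suc 2 = 3" "Suc 1 = 2" "4 - 1 = (3::nat)" by simp_all
  have h2: "hilbert_function K A m 2 = (hilbert_function K A m 1 + 1) choose 2" using hs by simp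
  note top = mpow_dims[OF hs(6)]
  have "V.sdim (mpow 4) = 1" using top(2) hs(5) by simp
  then have d3: "V.sdim (mpow 3) = n + 1" using sdim_mpow[of 3] hs(4) by (simp add: suc)
  have d0: "V.sdim (mpow 3) + V.sdim (mpow 2) = V.sdim (carrier A)"
    using d3 sdim_mpow[of 0] sdim_mpow[of 1] hs(1,2) by (simp add: suc(3)[symmetric])
  have orth: "orth (mpow 3) = mpow 2"
    using orth_mpow[OF top(1)] d0 by (simp add: suc)
  obtain W where W: "is_complement 1 W" by (rule complement_exists)
  note Wc = is_complementD[OF W]
  obtain S where S: "is_complement 2 S" "\<And>x y. x \<in> W \<Longrightarrow> y \<in> W \<Longrightarrow> x \<otimes>\<^bsub>A\<^esub> y \<in> S"
    by (rule products_complement[OF W h2]) blast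
  note Sc = is_complementD[OF S(1)]
  have q: "\<one>\<^bsub>K\<^esub> \<oplus>\<^bsub>K\<^esub> \<one>\<^bsub>K\<^esub> \<oplus>\<^bsub>K\<^esub> \<one>\<^bsub>K\<^esub> \<in> carrier K" by simp
  obtain k where k: "k \<in> carrier K" "(\<one>\<^bsub>K\<^esub> \<oplus>\<^bsub>K\<^esub> \<one>\<^bsub>K\<^esub> \<oplus>\<^bsub>K\<^esub> \<one>\<^bsub>K\<^esub>) \<otimes>\<^bsub>K\<^esub> k = \<ominus>\<^bsub>K\<^esub> \<one>\<^bsub>K\<^esub>"
    by (rule K.neg_inverse_exists[OF q K.three_ne_zero[OF char]])
  have S3: "S \<inter> mpow 3 = {\<zero>\<^bsub>A\<^esub>}" using Sc(3) by (simp add: suc)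
  obtain phi where phi: "phi \<in> module_hom K A A" "\<And>u. u \<in> carrier A \<Longrightarrow> phi u \<in> mpow 2"
    "\<And>u x. u \<in> carrier A \<Longrightarrow> x \<in> S \<Longrightarrow> lam (phi u \<otimes>\<^bsub>A\<^esub> x) = k \<otimes>\<^bsub>K\<^esub> lam (u \<otimes>\<^bsub>A\<^esub> x)"
    by (rule correction_exists[OF Sc(1) S3 mpow_subspace _ k(1), of "mpow 2"]) (use orth in blast)+
  let ?h = "\<lambda>u. u \<oplus>\<^bsub>A\<^esub> phi u"
  let ?W = "?h ` W"
  have W': "is_complement 1 ?W"
    by (rule shifted_complement[OF W phi(1)]) (use phi(2) in \<open>simp add: numeral_2_eq_2\<close>)
  \<comment> \<open>\<open>phi\<close> was built from \<open>S\<close>, the products of the old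
    \<open>W\<close>. The shifted space has its own span of products, and that span is the degree 2
    piece of the grading.\<close>
  obtain S' where S': "is_complement 2 S'" "\<And>x y. x \<in> ?W \<Longrightarrow> y \<in> ?W \<Longrightarrow> x \<otimes>\<^bsub>A\<^esub> y \<in> S'"
    "\<And>T. subspace K T A \<Longrightarrow> (\<And>x y. x \<in> ?W \<Longrightarrow> y \<in> ?W \<Longrightarrow> x \<otimes>\<^bsub>A\<^esub> y \<in> T) \<Longrightarrow> S' \<subseteq> T"
    by (rule products_complement[OF W' h2]) blast
  have zero: "x = \<zero>\<^bsub>A\<^esub>" if "x \<in> mpow i" "5 \<le> i" for x i
    using mpow_antimono[of "Suc 4" i] top(1) that by auto
  have lam: "lam (?h u \<otimes>\<^bsub>A\<^esub> (?h v \<otimes>\<^bsub>A\<^esub> ?h w)) = \<zero>\<^bsub>K\<^esub>" if u: "u \<in> W" and v: "v \<in> W" and w: "w \<in> W" for u v w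
  proof -
    have m1: "u \<in> mpow 1" "v \<in> mpow 1" "w \<in> mpow 1" using u v w Wc(2) by blast+
    note c = m1[THEN mpow_carrier]
    note p2 = phi(2)[OF c(1)] phi(2)[OF c(2)] phi(2)[OF c(3)]
    note pc = p2[THEN mpow_carrier]
    \<comment> \<open>Terms with at least two corrections: the degrees add up to 5, or to 6 when all
      three factors are corrections.\<close>
    have z: "u \<otimes>\<^bsub>A\<^esub> (phi v \<otimes>\<^bsub>A\<^esub> phi w) = \<zero>\<^bsub>A\<^esub>" "phi u \<otimes>\<^bsub>A\<^esub> (v \<otimes>\<^bsub>A\<^esub> phi w) = \<zero>\<^bsub>A\<^esub>"
      "phi u \<otimes>\<^bsub>A\<^esub> (phi v \<otimes>\<^bsub>A\<^esub> w) = \<zero>\<^bsub>A\<^esub>" "phi u \<otimes>\<^bsub>A\<^esub> (phi v \<otimes>\<^bsub>A\<^esub> phi w) = \<zero>\<^bsub>A\<^esub>"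
      by (rule zero, (rule mpow_mult_mem m1 p2)+, simp)+
    let ?l = "lam (u \<otimes>\<^bsub>A\<^esub> (v \<otimes>\<^bsub>A\<^esub> w))"
    have l: "?l \<in> carrier K" using c by simp
    have 1: "lam (phi u \<otimes>\<^bsub>A\<^esub> (v \<otimes>\<^bsub>A\<^esub> w)) = k \<otimes>\<^bsub>K\<^esub> ?l" by (rule phi(3)[OF c(1) S(2)[OF v w]])
    \<comment> \<open>The middle correction is moved to the front by commutativity, so that
      \<open>phi(3)\<close> applies with \<open>u w\<close> as the element of
      \<open>S\<close>.\<close>
    have 2: "lam (u \<otimes>\<^bsub>A\<^esub> (phi v \<otimes>\<^bsub>A\<^esub> w)) = k \<otimes>\<^bsub>K\<^esub> ?l"
      using phi(3)[OF c(2) S(2)[OF u w]] c pc by (simp add: m_lcomm)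
    have 3: "lam (u \<otimes>\<^bsub>A\<^esub> (v \<otimes>\<^bsub>A\<^esub> phi w)) = k \<otimes>\<^bsub>K\<^esub> ?l"
    proof -
      have "u \<otimes>\<^bsub>A\<^esub> (v \<otimes>\<^bsub>A\<^esub> phi w) = phi w \<otimes>\<^bsub>A\<^esub> (u \<otimes>\<^bsub>A\<^esub> v)" "w \<otimes>\<^bsub>A\<^esub> (u \<otimes>\<^bsub>A\<^esub> v) = u \<otimes>\<^bsub>A\<^esub> (v \<otimes>\<^bsub>A\<^esub> w)"
        using c pc by (simp_all add: m_ac)
      then show ?thesis using phi(3)[OF c(3) S(2)[OF u v]] by simp
    qed
    have "lam (?h u \<otimes>\<^bsub>A\<^esub> (?h v \<otimes>\<^bsub>A\<^esub> ?h w)) =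
        ?l \<oplus>\<^bsub>K\<^esub> (k \<otimes>\<^bsub>K\<^esub> ?l \<oplus>\<^bsub>K\<^esub> (k \<otimes>\<^bsub>K\<^esub> ?l \<oplus>\<^bsub>K\<^esub> k \<otimes>\<^bsub>K\<^esub> ?l))"
      using c pc k(1) by (simp add: l_distr r_distr lam_add 1 2 3 z K.a_ac)
    also have "\<dots> = ?l \<oplus>\<^bsub>K\<^esub> ((\<one>\<^bsub>K\<^esub> \<oplus>\<^bsub>K\<^esub> \<one>\<^bsub>K\<^esub> \<oplus>\<^bsub>K\<^esub> \<one>\<^bsub>K\<^esub>) \<otimes>\<^bsub>K\<^esub> k) \<otimes>\<^bsub>K\<^esub> ?l"
      using l k(1) by (simp add: K.l_distr K.a_assoc)
    also have "\<dots> = \<zero>\<^bsub>K\<^esub>" unfolding k(2) using l by (simp add: K.l_minus K.r_neg)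
    finally show ?thesis .
  qed
  have lam_WS: "lam (x \<otimes>\<^bsub>A\<^esub> y) = \<zero>\<^bsub>K\<^esub>" if x: "x \<in> ?W" and y: "y \<in> S'" for x y
  proof -
    have xc: "x \<in> carrier A" using x V.subspaceD(1)[OF is_complementD(1)[OF W']] by blast
    have "?W \<subseteq> carrier A" by (rule V.subspaceD(1)[OF is_complementD(1)[OF W']])
    \<comment> \<open>For fixed \<open>x\<close> the condition is linear in \<open>y\<close>;
      minimality of \<open>S'\<close> reduces it to products, that is, to \<open>lam\<close> on
      triple products.\<close>
    then have "S' \<subseteq> {y \<in> carrier A. lam (x \<otimes>\<^bsub>A\<^esub> y) = \<zero>\<^bsub>K\<^esub>}"
      by (intro S'(3)[OF subspace_lam_mult[OF V.subspace_carrier xc]]) (use x lam in auto)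
    then show ?thesis using y by blast
  qed
  \<comment> \<open>Only degrees 1 and 2 are ever used; the value at other indices is a
    filler.\<close>
  let ?C = "\<lambda>i::nat. if i = 1 then ?W else S'"
  show ?thesis
  proof (rule algebra_iso_of_pieces[where s = 4 and C = ?C])
    show "mpow (Suc 4) = {\<zero>\<^bsub>A\<^esub>}" by (rule top(1))
    show "mpow 4 \<noteq> {\<zero>\<^bsub>A\<^esub>}" using top(3) hs(5) by simp
    show "is_complement i (?C i)" if "0 < i" "i < 4 - 1" for i
    proof -
      have "i = 1 \<or> i = 2" using that by auto
      then show ?thesis using W' S'(1) by auto
    qed
    show "x \<otimes>\<^bsub>A\<^esub> y \<in> ?C (i + j)"
      if "0 < i" "0 < j" "i + j < 4 - 1" "x \<in> ?C i" "y \<in> ?C j" for i j x y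
    proof -
      have "i = 1" "j = 1" using that by auto
      then show ?thesis using S'(2) that(4,5) by simp
    qed
    show "lam (x \<otimes>\<^bsub>A\<^esub> y) = \<zero>\<^bsub>K\<^esub>"
      if "0 < i" "0 < j" "i + j = 4 - 1" "x \<in> ?C i" "y \<in> ?C j" for i j x y
    proof -
      have "i = 1 \<and> j = 2 \<or> i = 2 \<and> j = 1" using that by auto
      then show ?thesis
      proof
        assume "i = 1 \<and> j = 2"
        then show ?thesis using lam_WS that(4,5) by simp
      next
        assume "i = 2 \<and> j = 1"
        then have xy: "x \<in> S'" "y \<in> ?W" using that(4,5) by simp_all
        then have "x \<in> carrier A" "y \<in> carrier A"
          using V.subspaceD(1)[OF is_complementD(1)[OF S'(1)]] V.subspaceD(1)[OF is_complementD(1)[OF W']]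
          by blast+
        then show ?thesis using lam_WS[OF xy(2,1)] by (simp add: m_comm)
      qed
    qed
  qed simp
qed

end

theorem theorem1p1:
  fixes K :: "('k, 'r) ring_scheme"
    and A :: "('k, 'a, 's) module_scheme"
    and m :: "'a set"
    and n :: nat
  assumes "characteristic K \<noteq> 2" and "characteristic K \<noteq> 3"
    and "finite_local_algebra K A m"
    and "gorenstein K A"
    and "has_hilbert_vector K A m [1, n, n, 1] \<or>
         has_hilbert_vector K A m [1, n, (n + 1) choose 2, n, 1]"
  shows "algebra_iso K A (associated_graded A m) \<noteq> {}"
proof -
  obtain lam where "nondegenerate_functional K A m lam"
    using finite_local_algebra.gorenstein_functional[OF assms(3,4)] .
  then interpret nondegenerate_functional K A m lam .
  show ?thesis
    using assms(5) algebra_iso_socle_degree_3[OF assms(1)] algebra_iso_socle_degree_4[OF assms(2)] by blast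
qed

end
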